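(* Let $n,r\ge1$ and let $\sigma$ be a partition of $r$. Then the space $\mathrm{S}X_\sigma^*$ is a disjoint union of $N_\sigma$ copies of the subspace $\mathrm{S}\mathbf{F}_\sigma\subset \mathrm{SU}(r)/\mathrm{Stab}(\sigma)$, where $\mathrm{Stab}(\sigma)$ acts on $\mathrm{SU}(r)$ by conjugation.
   Context: $\Gamma_n=\langle a,b\mid [a^n,b]=1\rangle$; a representation $\rho:\Gamma_n\to\mathrm{SU}(r)$ is a pair $(A,B)\in\mathrm{SU}(r)^2$ with $[A^n,B]=\mathrm{id}$; it is irreducible if no proper nonzero subspace of $\mathbb{C}^r$ is invariant under both $A$ and $B$. $\mathrm{S}X_r^*$ is the space of irreducible representations $\Gamma_n\to\mathrm{SU}(r)$ modulo simultaneous $\mathrm{SU}(r)$-conjugation, with the quotient topology. A partition $\sigma$ of $r$ is $\sigma=(r_1,\overset{(a_1)}{\ldots},r_1,\ldots,r_s,\overset{(a_s)}{\ldots},r_s)$ with $r=a_1r_1+\cdots+a_sr_s$, $r_1>\cdots>r_s>0$, $a_i\ge1$. Let $\mathrm{Sym}^r(S^1)=(S^1)^r/S_r$ (unordered $r$-tuples with multiplicity), and let $\mathrm{Sym}^r_\sigma(S^1)$ be the subset of those $\{\lambda_1,\dots,\lambda_r\}$ in which exactly $a_i$ distinct values occur with multiplicity $r_i$, $i=1,\dots,s$. Let $\mathrm{SSym}^r_\sigma(S^1)\subset\mathrm{Sym}^r_\sigma(S^1)$ be the subset where $\lambda_1\cdots\lambda_r=1$. $\mathrm{S}X_\sigma^*\subset\mathrm{S}X_r^*$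 is the subspace of classes of $(A,B)$ such that the eigenvalues of $A$ form an element of $\mathrm{SSym}^r_\sigma(S^1)$. $N_\sigma$ is the number of elements $\{\lambda_1,\dots,\lambda_r\}\in\mathrm{SSym}^r_\sigma(S^1)$ such that $\lambda_1^n=\cdots=\lambda_r^n$ is an $r$-th root of unity. Fix $\{\lambda_1,\dots,\lambda_r\}\in\mathrm{Sym}^r_\sigma(S^1)$, ordered so that equal values are grouped in consecutive blocks of sizes given by $\sigma$, and set $A_\sigma=\mathrm{diag}(\lambda_1,\dots,\lambda_r)$. $\mathrm{Stab}(\sigma)$ is the stabilizer (centralizer) of $A_\sigma$ in $\mathrm{U}(r)$ under conjugation; it does not depend on the choice of the values. $\mathrm{S}\mathbf{F}_\sigma\subset\mathrm{SU}(r)/\mathrm{Stab}(\sigma)$ is the image of the set of those $B\in\mathrm{SU}(r)$ that have no proper nonzero invariant subspace in common with $A_\sigma$ (this set depends only on $\sigma$). *)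

theory Defs
  imports "HOL-Analysis.Analysis" "HOL-Computational_Algebra.Polynomial"
begin

subsection \<open>Matrices\<close>

type_synonym 'r cmat = "complex^'r^'r"

definition conj_transpose :: "('r::finite) cmat \<Rightarrow> 'r cmat" where
  "conj_transpose A = (\<chi> i j. cnj (A $ j $ i))"

definition U_mats :: "('r::finite) cmat set" where
  "U_mats = {A. conj_transpose A ** A = mat 1 \<and> A ** conj_transpose A = mat 1}"

definition SU_mats :: "('r::finite) cmat set" where
  "SU_mats = {A \<in> U_mats. det A = 1}"

(* The class-level power A ^ n on this type would be taken entrywise. *)
definition mat_pow :: "('r::finite) cmat \<Rightarrow> nat \<Rightarrow> 'r cmat" where
  "mat_pow A n = (((**) A) ^^ n) (mat 1)"

definition commutator :: "('r::finite) cmat \<Rightarrow> 'r cmat \<Rightarrow> 'r cmat" where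
  "commutator A B = A ** B ** matrix_inv A ** matrix_inv B"

definition conjugate :: "('r::finite) cmat \<Rightarrow> 'r cmat \<Rightarrow> 'r cmat" where
  "conjugate P A = P ** A ** matrix_inv P"

definition diag :: "complex^'r \<Rightarrow> 'r cmat" where
  "diag l = (\<chi> i j. if i = j then l $ i else 0)"

definition char_poly :: "('r::finite) cmat \<Rightarrow> complex poly" where
  "char_poly A = det (\<chi> i j. (if i = j then [:0, 1:] else 0) - [:A $ i $ j:])"

(* Eigenvalues with algebraic multiplicity. *)
definition eigenvalues :: "('r::finite) cmat \<Rightarrow> complex multiset" where
  "eigenvalues A = proots (char_poly A)"

definition irreducible_pair :: "('r::finite) cmat \<Rightarrow> 'r cmat \<Rightarrow> bool" where
  "irreducible_pair A B \<longleftrightarrow>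
    (\<forall>W. vec.subspace W \<and> (\<forall>v\<in>W. A *v v \<in> W) \<and> (\<forall>v\<in>W. B *v v \<in> W)
      \<longrightarrow> W = {0} \<or> W = UNIV)"


subsection \<open>Quotient spaces\<close>

definition quotient_topology :: "'a topology \<Rightarrow> ('a \<Rightarrow> 'b) \<Rightarrow> 'b topology" where
  "quotient_topology X q =
    topology (\<lambda>V. V \<subseteq> q ` topspace X \<and> openin X {x \<in> topspace X. q x \<in> V})"

lemma openin_quotient_topology:
  "openin (quotient_topology X q) V \<longleftrightarrow>
    V \<subseteq> q ` topspace X \<and> openin X {x \<in> topspace X. q x \<in> V}"
proof -
  have "istopology (\<lambda>V. V \<subseteq> q ` topspace X \<and> openin X {x \<in> topspace X. q x \<in> V})"
    unfolding istopology_def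
  proof (intro conjI allI impI)
    fix S T
    assume S: "S \<subseteq> q ` topspace X \<and> openin X {x \<in> topspace X. q x \<in> S}"
      and T: "T \<subseteq> q ` topspace X \<and> openin X {x \<in> topspace X. q x \<in> T}"
    show "S \<inter> T \<subseteq> q ` topspace X" using S by blast
    have "{x \<in> topspace X. q x \<in> S \<inter> T}
        = {x \<in> topspace X. q x \<in> S} \<inter> {x \<in> topspace X. q x \<in> T}" by blast
    then show "openin X {x \<in> topspace X. q x \<in> S \<inter> T}" using S T
      by (simp only: openin_Int)
  next
    fix K
    assume K: "\<forall>V\<in>K. V \<subseteq> q ` topspace X \<and> openin X {x \<in> topspace X. q x \<in> V}"
    then show "\<Union>K \<subseteq> q ` topspace X" by blast
    have "{x \<in> topspace X. q x \<in> \<Union>K} = (\<Union>V\<in>K. {x \<in> topspace X. q x \<in> V})" by blast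
    then show "openin X {x \<in> topspace X. q x \<in> \<Union>K}" using K
      by (simp only:) (blast intro: openin_Union)
  qed
  then show ?thesis by (simp add: quotient_topology_def topology_inverse')
qed

lemma topspace_quotient_topology: "topspace (quotient_topology X q) = q ` topspace X"
proof (rule antisym)
  show "topspace (quotient_topology X q) \<subseteq> q ` topspace X"
    using openin_topspace[of "quotient_topology X q"] unfolding openin_quotient_topology by blast
  have "{x \<in> topspace X. q x \<in> q ` topspace X} = topspace X" by blast
  then have "openin (quotient_topology X q) (q ` topspace X)"
    by (simp add: openin_quotient_topology)
  then show "q ` topspace X \<subseteq> topspace (quotient_topology X q)" by (rule openin_subset)
qed

lemma quotient_map_quotient_topology: "quotient_map X (quotient_topology X q) q"
  by (auto simp: quotient_map_def topspace_quotient_topology openin_quotient_topology)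


subsection \<open>Partitions and unordered tuples\<close>

(* A partition lists its parts, with repetition, in decreasing order. *)
definition is_partition :: "nat list \<Rightarrow> nat \<Rightarrow> bool" where
  "is_partition \<sigma> r \<longleftrightarrow> sorted_wrt (\<ge>) \<sigma> \<and> 0 \<notin> set \<sigma> \<and> sum_list \<sigma> = r"

(* Unordered r-tuples, r being the sum of the parts, are multisets of size r.
   If k = r_i is a part, then count_list \<sigma> k is its multiplicity a_i in the partition. *)
definition Sym :: "nat list \<Rightarrow> complex multiset set" where
  "Sym \<sigma> = {M. size M = sum_list \<sigma> \<and> set_mset M \<subseteq> sphere 0 1 \<and>
    (\<forall>k \<in> set \<sigma>. card {z \<in> set_mset M. count M z = k} = count_list \<sigma> k)}"

definition SSym :: "nat list \<Rightarrow> complex multiset set" where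
  "SSym \<sigma> = {M \<in> Sym \<sigma>. prod_mset M = 1}"

definition SSym_roots :: "nat \<Rightarrow> nat list \<Rightarrow> complex multiset set" where
  "SSym_roots n \<sigma> = {M \<in> SSym \<sigma>. \<exists>\<omega>. \<omega> ^ sum_list \<sigma> = 1 \<and> (\<forall>z \<in># M. z ^ n = \<omega>)}"

definition N_count :: "nat \<Rightarrow> nat list \<Rightarrow> nat" where
  "N_count n \<sigma> = card (SSym_roots n \<sigma>)"

lemma finite_SSym_roots:
  assumes "n \<ge> 1" "sum_list \<sigma> \<ge> 1"
  shows "finite (SSym_roots n \<sigma>)"
proof (rule finite_subset)
  let ?S = "{z::complex. z ^ (n * sum_list \<sigma>) = 1}"
  show "SSym_roots n \<sigma> \<subseteq> {M. set_mset M \<subseteq> ?S \<and> size M = sum_list \<sigma>}"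
  proof
    fix M assume "M \<in> SSym_roots n \<sigma>"
    then obtain \<omega> where "size M = sum_list \<sigma>" "\<omega> ^ sum_list \<sigma> = 1" "\<forall>z\<in>#M. z ^ n = \<omega>"
      unfolding SSym_roots_def SSym_def Sym_def by blast
    then show "M \<in> {M. set_mset M \<subseteq> ?S \<and> size M = sum_list \<sigma>}"
      by (simp add: power_mult subset_iff)
  qed
  have "finite ?S"
    using assms finite_roots_unity[of "n * sum_list \<sigma>", where ?'a = complex] by simp
  then show "finite {M. set_mset M \<subseteq> ?S \<and> size M = sum_list \<sigma>}"
    using finite_multisets_of_size[of ?S "sum_list \<sigma>"]
    unfolding multisets_of_size_def by blast
qed

(* The order on the index type turns a vector into a list; its entries are grouped into
   consecutive blocks of equal values, of the sizes given by the partition. *)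
definition in_blocks :: "nat list \<Rightarrow> complex^('r::{finite,linorder}) \<Rightarrow> bool" where
  "in_blocks \<sigma> l \<longleftrightarrow>
    (\<exists>vs. distinct vs \<and> length vs = length \<sigma> \<and>
      map (($) l) (sorted_list_of_set UNIV) = concat (map2 replicate \<sigma> vs))"

definition entries :: "complex^'r \<Rightarrow> complex multiset" where
  "entries l = image_mset (($) l) (mset_set UNIV)"


subsection \<open>Representation spaces\<close>

definition irr_reps :: "nat \<Rightarrow> (('r::finite) cmat \<times> 'r cmat) set" where
  "irr_reps n = {(A, B). A \<in> SU_mats \<and> B \<in> SU_mats \<and>
    commutator (mat_pow A n) B = mat 1 \<and> irreducible_pair A B}"

definition rep_class ::
    "('r::finite) cmat \<times> 'r cmat \<Rightarrow> ('r cmat \<times> 'r cmat) set" where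
  "rep_class \<rho> = {(conjugate P (fst \<rho>), conjugate P (snd \<rho>)) | P. P \<in> SU_mats}"

definition SX :: "nat \<Rightarrow> (('r::finite) cmat \<times> 'r cmat) set topology" where
  "SX n = quotient_topology (top_of_set (irr_reps n)) rep_class"

definition SX_part :: "nat \<Rightarrow> nat list \<Rightarrow> (('r::finite) cmat \<times> 'r cmat) set topology" where
  "SX_part n \<sigma> = subtopology (SX n)
    {rep_class (A, B) | A B. (A, B) \<in> irr_reps n \<and> eigenvalues A \<in> SSym \<sigma>}"


subsection \<open>The fibre\<close>

(* The partition enters only through the chosen eigenvalue vector l, with A = diag l. *)
definition Stab :: "complex^'r \<Rightarrow> 'r cmat set" where
  "Stab l = {P \<in> U_mats. conjugate P (diag l) = diag l}"

definition Stab_class :: "complex^'r \<Rightarrow> 'r cmat \<Rightarrow> 'r cmat set" where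
  "Stab_class l B = {conjugate P B | P. P \<in> Stab l}"

definition SU_mod_Stab :: "complex^'r \<Rightarrow> 'r cmat set topology" where
  "SU_mod_Stab l = quotient_topology (top_of_set SU_mats) (Stab_class l)"

definition SF :: "complex^'r \<Rightarrow> 'r cmat set topology" where
  "SF l = subtopology (SU_mod_Stab l)
    (Stab_class l ` {B \<in> SU_mats. irreducible_pair (diag l) B})"

end

theory Submission
  imports Defs "HOL-Computational_Algebra.Fundamental_Theorem_Algebra" "HOL-Combinatorics.Permutations"
begin

text \<open>
  Let \<open>(A, B)\<close> be an irreducible representation.  As \<open>A^n\<close> commutes with both \<open>A\<close> and \<open>B\<close>, Schur's
  lemma (\<open>irreducible_pair_schur\<close>) makes it a scalar \<open>\<omega>\<close>, and \<open>det A = 1\<close> gives \<open>\<omega>^r = 1\<close>.  Hence the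
  spectrum of \<open>A\<close> is one of the finitely many tuples counted by \<open>N_count\<close>, and for the spectral
  type \<open>\<sigma>\<close> the whole remaining freedom lies in \<open>B\<close>.

  Every tuple \<open>M\<close> of type \<open>\<sigma>\<close> is the spectrum of a diagonal matrix \<open>diag m\<close> whose entries coincide in
  exactly the same positions as those of \<open>l\<close> (\<open>ex_vector_same_kernel\<close>).  Then \<open>diag m\<close> and \<open>diag l\<close> are
  polynomials in each other, so they have the same invariant subspaces and the same stabilizer, and
  the fibre over \<open>M\<close> is the fibre built from \<open>l\<close>.  By the spectral theorem (\<open>U_mats_diagonalizable\<close>)
  each class with spectrum \<open>M\<close> has a representative \<open>(diag m, B)\<close>, and \<open>B\<close> is unique up to
  conjugation by \<open>Stab l\<close>; passing between \<open>U(r)\<close> and \<open>SU(r)\<close> costs only a scalar, which acts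
  trivially by conjugation (\<open>ex_SU_same_conjugation\<close>).  This identifies the two sides as sets.

  For the topologies, let \<open>F\<close> be the set of the \<open>B\<close> that are irreducible together with \<open>diag l\<close> and
  let \<open>I\<close> index the tuples.  Both spaces turn out to be quotients of \<open>I \<times> F\<close> with the same fibres.
  For the sum of copies of \<open>SF l\<close> this holds since orbit maps are open and therefore restrict to
  quotient maps on saturated subspaces.  For \<open>SX_part n \<sigma>\<close> one has to choose diagonalizations of \<open>A\<close>
  continuously, at least up to the quotient, and compactness of \<open>SU(r)\<close> does that: the map
  \<open>(i, P, B) \<mapsto> (P D_i P^-1, P B P^-1)\<close>, where \<open>D_i\<close> is the diagonal matrix of the tuple \<open>i\<close>, has a
  compact domain \<open>I \<times> SU(r) \<times> SU(r)\<close>, so it is closed, and a closed map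
  stays closed on the full preimage of the set of irreducible representations
  (\<open>compact_map_restrict_quotient\<close>).  Its composition with the orbit map is a quotient map that
  does not depend on \<open>P\<close>.
\<close>


section \<open>Eigenvectors in invariant subspaces\<close>

text \<open>The vector \<open>p(A) v\<close>.\<close>

definition poly_act :: "('r::finite) cmat \<Rightarrow> complex poly \<Rightarrow> complex^'r \<Rightarrow> complex^'r" where
  "poly_act A p v = (\<Sum>i\<le>degree p. coeff p i *s (((*v) A ^^ i) v))"

lemma funpow_diff_smult:
  fixes A :: "('r::finite) cmat"
  shows "((*v) A ^^ i) (A *v v - c *s v) = ((*v) A ^^ Suc i) v - c *s ((*v) A ^^ i) v"
proof (induction i)
  case (Suc i)
  then show ?case
    by (simp add: matrix_vector_mult_diff_distrib vector_scalar_commute)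
qed simp

text \<open>For peeling the linear factors off an annihilating polynomial one at a time, acting on the vector
  with each.\<close>

lemma poly_act_linear_factor:
  assumes "q \<noteq> 0"
  shows "poly_act A ([:-c, 1:] * q) v = poly_act A q (A *v v - c *s v)"
proof -
  let ?x = "\<lambda>i. ((*v) A ^^ i) v"
  let ?d = "degree q"
  have deg: "degree ([:-c, 1:] * q) = Suc ?d"
    using assms by (subst degree_mult_eq) auto
  have co: "coeff ([:-c, 1:] * q) i = coeff (pCons 0 q) i - c * coeff q i" for i
    by (simp add: coeff_pCons split: nat.split)
  have "poly_act A ([:-c, 1:] * q) v = (\<Sum>i\<le>Suc ?d. (coeff (pCons 0 q) i - c * coeff q i) *s ?x i)"
    unfolding poly_act_def deg co ..
  also have "\<dots> = (\<Sum>i\<le>Suc ?d. coeff (pCons 0 q) i *s ?x i) - (\<Sum>i\<le>Suc ?d. (c * coeff q i) *s ?x i)"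
    by (simp only: vector_sub_rdistrib sum_subtractf)
  also have "(\<Sum>i\<le>Suc ?d. coeff (pCons 0 q) i *s ?x i) = (\<Sum>i\<le>?d. coeff q i *s ?x (Suc i))"
    by (subst sum.atMost_Suc_shift) simp
  also have "(\<Sum>i\<le>Suc ?d. (c * coeff q i) *s ?x i) = (\<Sum>i\<le>?d. (c * coeff q i) *s ?x i)"
    by (simp add: coeff_eq_0)
  also have "(\<Sum>i\<le>?d. coeff q i *s ?x (Suc i)) - (\<Sum>i\<le>?d. (c * coeff q i) *s ?x i)
      = poly_act A q (A *v v - c *s v)"
    unfolding poly_act_def funpow_diff_smult
    by (simp add: sum_subtractf[symmetric] vector_ssub_ldistrib vector_smult_assoc mult.commute)
  finally show ?thesis .
qed

text \<open>The \<open>r + 1\<close> vectors \<open>v, A v, \<dots>, A^r v\<close> are linearly dependent in a space of dimension \<open>r\<close>,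
  either as a set or because two of them coincide.\<close>

lemma ex_annihilating_poly:
  fixes A :: "('r::finite) cmat"
  shows "\<exists>p. p \<noteq> 0 \<and> poly_act A p v = 0"
proof -
  let ?N = "CARD('r)"
  let ?x = "\<lambda>i. ((*v) A ^^ i) v"
  have build: "\<exists>p. p \<noteq> 0 \<and> poly_act A p v = 0"
    if c: "(\<Sum>i\<le>?N. c i *s ?x i) = 0" and j: "j \<le> ?N" "c j \<noteq> 0" for c j
  proof -
    define p where "p = (\<Sum>i\<le>?N. monom (c i) i)"
    have co: "coeff p i = (if i \<le> ?N then c i else 0)" for i
      unfolding p_def by (simp add: coeff_sum)
    have "p \<noteq> 0" using co[of j] j by auto
    moreover have "degree p \<le> ?N" by (rule degree_le) (simp add: co)
    then have "poly_act A p v = (\<Sum>i\<le>?N. coeff p i *s ?x i)"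
      unfolding poly_act_def by (intro sum.mono_neutral_left) (auto simp: coeff_eq_0)
    then have "poly_act A p v = 0" using c by (simp add: co)
    ultimately show ?thesis by blast
  qed
  show ?thesis
  proof (cases "inj_on ?x {..?N}")
    case False
    then obtain i j where ij: "i \<le> ?N" "j \<le> ?N" "i \<noteq> j" "?x i = ?x j"
      by (auto simp: inj_on_def)
    \<comment> \<open>The polynomial \<open>x^i - x^j\<close> annihilates \<open>v\<close>.\<close>
    let ?c = "\<lambda>k. (if k = i then 1 else 0) - (if k = j then 1 else 0 :: complex)"
    have "(\<Sum>k\<le>?N. ?c k *s ?x k) = (\<Sum>k\<le>?N. (if k = i then ?x k else 0)) - (\<Sum>k\<le>?N. (if k = j then ?x k else 0))"
      unfolding sum_subtractf[symmetric] by (intro sum.cong) auto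
    also have "\<dots> = 0" using ij by simp
    finally show ?thesis using build[of ?c i] ij by auto
  next
    case True
    let ?S = "?x ` {..?N}"
    have "card ?S = Suc ?N" using True by (simp add: card_image)
    have "vec.dependent ?S"
    proof (rule ccontr)
      assume "\<not> vec.dependent ?S"
      then have "card ?S \<le> vec.dim (UNIV :: (complex^'r) set)"
        by (intro vec.independent_card_le_dim) auto
      then show False using \<open>card ?S = Suc ?N\<close> by (simp add: vec.dim_UNIV card_cart_basis)
    qed
    then obtain u w where u: "w \<in> ?S" "u w \<noteq> 0" "(\<Sum>v\<in>?S. u v *s v) = 0"
      by (auto simp: vec.dependent_finite)
    then obtain j where "j \<le> ?N" "w = ?x j" by auto
    moreover have "(\<Sum>i\<le>?N. u (?x i) *s ?x i) = 0"
      using u(3) True by (simp add: sum.reindex)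
    ultimately show ?thesis using build[of "\<lambda>i. u (?x i)" j] u(2) by auto
  qed
qed

text \<open>Split an annihilating polynomial of \<open>v\<close> over \<open>\<complex>\<close> into linear factors and apply these to \<open>v\<close> in
  turn.  The result is eventually \<open>0\<close>, and the last nonzero vector on the way, which still lies in \<open>W\<close>,
  is an eigenvector.  The subspace \<open>W\<close> matters for the construction of orthonormal eigenvectors, and
  \<open>W = UNIV\<close> for Schur's lemma.\<close>

lemma ex_eigenvector_in_invariant_subspace:
  fixes A :: "('r::finite) cmat"
  assumes W: "vec.subspace W" "\<And>v. v \<in> W \<Longrightarrow> A *v v \<in> W" and v: "v \<in> W" "v \<noteq> 0"
  shows "\<exists>w c. w \<in> W \<and> w \<noteq> 0 \<and> A *v w = c *s w"
proof -
  have "\<exists>w c. w \<in> W \<and> w \<noteq> 0 \<and> A *v w = c *s w"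
    if "p \<noteq> 0" "poly_act A p v = 0" "v \<in> W" "v \<noteq> 0" for p v
    using that
  proof (induction "degree p" arbitrary: p v)
    case 0
    then obtain a where "p = [:a:]" using degree_0_id by metis
    with 0 show ?case by (simp add: poly_act_def)
  next
    case (Suc d)
    then have "\<not> constant (poly p)" by (simp add: constant_degree)
    then obtain c where "poly p c = 0" using fundamental_theorem_of_algebra by blast
    then obtain q where q: "p = [:-c, 1:] * q" by (auto simp: poly_eq_0_iff_dvd)
    with Suc.prems have "q \<noteq> 0" by auto
    have "degree p = Suc (degree q)"
      unfolding q using \<open>q \<noteq> 0\<close> by (subst degree_mult_eq) auto
    let ?w = "A *v v - c *s v"
    show ?case
    proof (cases "?w = 0")
      case True
      then show ?thesis using Suc.prems by (intro exI[of _ v] exI[of _ c]) auto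
    next
      case False
      show ?thesis
      proof (rule Suc.hyps(1))
        show "d = degree q" using \<open>degree p = Suc (degree q)\<close> Suc.hyps by simp
        show "poly_act A q ?w = 0"
          using Suc.prems(2) poly_act_linear_factor[OF \<open>q \<noteq> 0\<close>, of A c v] q by metis
        show "?w \<in> W" using W Suc.prems(3) by (intro vec.subspace_diff vec.subspace_scale)
      qed (use False \<open>q \<noteq> 0\<close> in auto)
    qed
  qed
  then show ?thesis using ex_annihilating_poly[of A v] v by blast
qed


section \<open>Unitary matrices, conjugation and eigenvalues\<close>

lemma mat_mult_component: "(A ** B) $ i $ j = (\<Sum>k\<in>UNIV. A $ i $ k * B $ k $ j)"
  by (simp add: matrix_matrix_mult_def)

lemma mat_scalar_left: "(mat c ** A) $ i $ j = c * A $ i $ j"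
  by (simp add: mat_mult_component mat_def if_distrib[of "\<lambda>x. x * _"] cong: if_cong)

lemma mat_scalar_commute: "A ** mat c = mat c ** (A :: 'a::comm_ring_1^'r^'r)"
  by (simp add: vec_eq_iff mat_scalar_left)
     (simp add: mat_mult_component mat_def if_distrib cong: if_cong)

lemma mat_mult_mat: "mat c ** mat d = (mat (c * d) :: 'a::comm_ring_1^'r^'r)"
  by (simp add: vec_eq_iff mat_scalar_left) (simp add: mat_def)

lemma mat_mult_vec: "mat c *v x = c *s (x :: 'a::comm_ring_1^'r)"
  by (simp add: vec_eq_iff matrix_vector_mult_def mat_def if_distrib[of "\<lambda>x. x * _"] cong: if_cong)

lemma det_mat_scalar: "det (mat c :: 'a::comm_ring_1^'r^'r) = c ^ CARD('r)"
  by (subst det_diagonal) (auto simp: mat_def)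

lemma det_diag: "det (diag m :: ('r::finite) cmat) = (\<Prod>i\<in>UNIV. m $ i)"
  by (subst det_diagonal) (auto simp: diag_def)

lemma diag_mult_component: "(diag m ** A) $ i $ j = m $ i * A $ i $ j"
  by (simp add: mat_mult_component diag_def if_distrib[of "\<lambda>x. x * _"] cong: if_cong)

lemma mult_diag_component: "(A ** diag m) $ i $ j = A $ i $ j * m $ j"
  by (simp add: mat_mult_component diag_def if_distrib cong: if_cong)

lemma diag_mult_vec: "diag m *v x = (\<chi> i. m $ i * x $ i)"
  by (simp add: vec_eq_iff matrix_vector_mult_def diag_def if_distrib[of "\<lambda>x. x * _"] cong: if_cong)

lemma conj_transpose_component [simp]: "conj_transpose A $ i $ j = cnj (A $ j $ i)"
  by (simp add: conj_transpose_def)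

lemma conj_transpose_mult: "conj_transpose (A ** B) = conj_transpose B ** conj_transpose A"
  by (simp add: vec_eq_iff mat_mult_component cnj_sum mult.commute)

lemma conj_transpose_conj_transpose [simp]: "conj_transpose (conj_transpose A) = A"
  by (simp add: vec_eq_iff)

lemma conj_transpose_mat: "conj_transpose (mat c) = mat (cnj c)"
  by (auto simp: vec_eq_iff mat_def)

lemma det_conj_transpose: "det (conj_transpose A) = cnj (det (A :: ('r::finite) cmat))"
proof -
  have "det (conj_transpose A) = det (\<chi> i j. cnj (A $ i $ j))"
    by (subst det_transpose[symmetric]) (simp add: transpose_def conj_transpose_def)
  also have "\<dots> = cnj (det A)"
    by (simp add: det_def cnj_sum cnj_prod)
  finally show ?thesis .
qed

lemma U_matsI: "conj_transpose A ** A = mat 1 \<Longrightarrow> A \<in> U_mats"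
  using matrix_left_right_inverse[of A "conj_transpose A"] by (simp add: U_mats_def)

lemma U_mats_left: "A \<in> U_mats \<Longrightarrow> conj_transpose A ** A = mat 1"
  and U_mats_right: "A \<in> U_mats \<Longrightarrow> A ** conj_transpose A = mat 1"
  by (simp_all add: U_mats_def)

lemma U_mats_mat_1: "mat 1 \<in> U_mats"
  by (rule U_matsI) (simp add: conj_transpose_mat)

lemma U_mats_mult:
  assumes "A \<in> U_mats" "B \<in> U_mats" shows "A ** B \<in> U_mats"
proof (rule U_matsI)
  have "conj_transpose (A ** B) ** (A ** B) = conj_transpose B ** (conj_transpose A ** A) ** B"
    by (simp add: conj_transpose_mult matrix_mul_assoc)
  then show "conj_transpose (A ** B) ** (A ** B) = mat 1"
    using assms by (simp add: U_mats_left)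
qed

lemma U_mats_conj_transpose: "A \<in> U_mats \<Longrightarrow> conj_transpose A \<in> U_mats"
  by (simp add: U_mats_def)

lemma U_mats_mat: "cmod c = 1 \<Longrightarrow> mat c \<in> U_mats"
  by (rule U_matsI) (simp add: conj_transpose_mat mat_mult_mat complex_norm_square[symmetric] mult.commute)

lemma U_mats_diag: "(\<And>i. cmod (m $ i) = 1) \<Longrightarrow> diag m \<in> U_mats"
  by (rule U_matsI, unfold vec_eq_iff mult_diag_component)
    (auto simp: mat_def diag_def complex_norm_square[symmetric] mult.commute)

lemma norm_det_U_mats:
  assumes "A \<in> U_mats" shows "cmod (det A) = 1"
proof -
  have "cnj (det A) * det A = 1"
    using arg_cong[OF U_mats_left[OF assms], of det] by (simp add: det_mul det_conj_transpose)
  then have "cmod (cnj (det A) * det A) = 1" by simp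
  then have "(cmod (det A))\<^sup>2 = 1" by (simp add: norm_mult power2_eq_square)
  then show ?thesis using norm_ge_zero[of "det A"] by (simp add: power2_eq_1_iff)
qed

lemma SU_mats_imp_U: "A \<in> SU_mats \<Longrightarrow> A \<in> U_mats"
  by (simp add: SU_mats_def)

lemma SU_mats_mat_1: "mat 1 \<in> SU_mats"
  by (simp add: SU_mats_def U_mats_mat_1)

lemma SU_mats_mult: "A \<in> SU_mats \<Longrightarrow> B \<in> SU_mats \<Longrightarrow> A ** B \<in> SU_mats"
  by (simp add: SU_mats_def U_mats_mult det_mul)

lemma SU_mats_conj_transpose: "A \<in> SU_mats \<Longrightarrow> conj_transpose A \<in> SU_mats"
  by (simp add: SU_mats_def U_mats_conj_transpose det_conj_transpose)

lemma matrix_inv_U_mats: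
  assumes "P \<in> U_mats" shows "matrix_inv P = conj_transpose P"
proof -
  have "P ** matrix_inv P = mat 1 \<and> matrix_inv P ** P = mat 1"
    unfolding matrix_inv_def
    by (rule someI[of _ "conj_transpose P"]) (simp add: assms U_mats_left U_mats_right)
  then have "matrix_inv P ** P ** conj_transpose P = conj_transpose P" by simp
  then show ?thesis by (simp add: matrix_mul_assoc[symmetric] assms U_mats_right)
qed

lemma conjugate_U: "P \<in> U_mats \<Longrightarrow> conjugate P A = P ** A ** conj_transpose P"
  by (simp add: conjugate_def matrix_inv_U_mats)

lemma conjugate_mat_1 [simp]: "conjugate (mat 1) A = A"
  by (simp add: conjugate_U U_mats_mat_1 conj_transpose_mat)

lemma conjugate_conjugate:
  "P \<in> U_mats \<Longrightarrow> Q \<in> U_mats \<Longrightarrow> conjugate P (conjugate Q A) = conjugate (P ** Q) A"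
  by (simp add: conjugate_U U_mats_mult conj_transpose_mult matrix_mul_assoc)

lemma conjugate_inverse:
  assumes "P \<in> U_mats"
  shows "conjugate (conj_transpose P) (conjugate P A) = A"
    and "conjugate P (conjugate (conj_transpose P) A) = A"
  using assms by (simp_all add: conjugate_conjugate U_mats_conj_transpose U_mats_left U_mats_right)

lemma conjugate_mult:
  assumes "P \<in> U_mats" shows "conjugate P (A ** B) = conjugate P A ** conjugate P B"
proof -
  have "conjugate P A ** conjugate P B = P ** A ** (conj_transpose P ** P) ** B ** conj_transpose P"
    using assms by (simp add: conjugate_U matrix_mul_assoc)
  then show ?thesis using assms by (simp add: U_mats_left conjugate_U matrix_mul_assoc)
qed

lemma conjugate_scalar: "P \<in> U_mats \<Longrightarrow> conjugate P (mat c) = mat c"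
  by (simp only: conjugate_U mat_scalar_commute[of P] matrix_mul_assoc[symmetric] U_mats_right
      matrix_mul_rid)

lemma conjugate_eq_iff_commute:
  assumes "P \<in> U_mats" shows "conjugate P A = B \<longleftrightarrow> P ** A = B ** P"
proof
  assume "conjugate P A = B"
  then have "B ** P = P ** A ** (conj_transpose P ** P)"
    using assms by (auto simp add: conjugate_U matrix_mul_assoc)
  then show "P ** A = B ** P" using assms by (simp add: U_mats_left)
next
  assume "P ** A = B ** P"
  then show "conjugate P A = B"
    using assms by (simp add: conjugate_U matrix_mul_assoc[symmetric] U_mats_right)
qed

lemma conjugate_scaled:
  assumes "P \<in> U_mats" "cmod c = 1"
  shows "conjugate (mat c ** P) A = conjugate P A"
proof -
  have "conjugate (mat c) (conjugate P A) = conjugate P A"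
    using assms by (simp only: conjugate_eq_iff_commute[OF U_mats_mat] mat_scalar_commute)
  then show ?thesis using assms by (simp add: conjugate_conjugate U_mats_mat)
qed

lemma U_mats_conjugate: "P \<in> U_mats \<Longrightarrow> A \<in> U_mats \<Longrightarrow> conjugate P A \<in> U_mats"
  by (simp add: conjugate_U U_mats_mult U_mats_conj_transpose)

lemma det_conjugate:
  assumes "P \<in> U_mats" shows "det (conjugate P A) = det A"
proof -
  have "det P * det (conj_transpose P) = 1"
    using arg_cong[OF U_mats_right[OF assms], of det] by (simp add: det_mul)
  then show ?thesis using assms by (simp add: conjugate_U det_mul)
qed

lemma SU_mats_conjugate: "P \<in> U_mats \<Longrightarrow> A \<in> SU_mats \<Longrightarrow> conjugate P A \<in> SU_mats"
  by (simp add: SU_mats_def U_mats_conjugate det_conjugate)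

text \<open>Dividing \<open>P\<close> by an \<open>r\<close>-th root of its determinant, which has absolute value 1, gives a matrix of
  determinant 1 and changes nothing in the conjugation.\<close>

lemma ex_SU_same_conjugation:
  assumes P: "P \<in> U_mats"
  shows "\<exists>Q\<in>SU_mats. conjugate Q = (conjugate P :: ('r::finite) cmat \<Rightarrow> 'r cmat)"
proof -
  let ?N = "CARD('r)"
  define c where "c = cis (- (Arg (det P) / real ?N))"
  have "det P = cis (Arg (det P))"
    using norm_det_U_mats[OF P] by (subst cis_Arg) (auto simp: sgn_eq)
  moreover have "c ^ ?N = cis (- Arg (det P))" unfolding c_def Complex.DeMoivre by simp
  ultimately have "c ^ ?N * det P = cis (- Arg (det P)) * cis (Arg (det P))" by simp
  then have "c ^ ?N * det P = 1" by (simp only: cis_mult) simp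
  moreover have c: "cmod c = 1" by (simp add: c_def)
  ultimately have "mat c ** P \<in> SU_mats"
    by (simp add: SU_mats_def U_mats_mult U_mats_mat P det_mul det_mat_scalar)
  moreover have "conjugate (mat c ** P) = conjugate P"
    using conjugate_scaled[OF P c] by blast
  ultimately show ?thesis by blast
qed

lemma mat_pow_0 [simp]: "mat_pow A 0 = mat 1"
  and mat_pow_Suc [simp]: "mat_pow A (Suc n) = A ** mat_pow A n"
  by (simp_all add: mat_pow_def)

lemma mat_pow_U: "A \<in> U_mats \<Longrightarrow> mat_pow A n \<in> U_mats"
  by (induction n) (simp_all add: U_mats_mat_1 U_mats_mult)

lemma mat_pow_commute: "A ** mat_pow A n = mat_pow A n ** A"
  by (induction n) (simp_all, metis matrix_mul_assoc)

lemma det_mat_pow: "det (mat_pow A n) = det A ^ n"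
  by (induction n) (simp_all add: det_mul)

lemma mat_pow_diag: "mat_pow (diag m) n = diag (\<chi> i. m $ i ^ n)"
  by (induction n) (auto simp: vec_eq_iff diag_mult_component, auto simp: diag_def mat_def)

lemma mat_pow_conjugate: "P \<in> U_mats \<Longrightarrow> mat_pow (conjugate P A) n = conjugate P (mat_pow A n)"
  by (induction n) (simp_all add: conjugate_mult conjugate_scalar)

lemma commutator_eq_1_iff:
  assumes "A \<in> U_mats" "B \<in> U_mats"
  shows "commutator A B = mat 1 \<longleftrightarrow> A ** B = B ** A"
proof -
  have "commutator A B = conjugate A B ** conj_transpose B"
    using assms by (simp add: commutator_def conjugate_def matrix_inv_U_mats)
  also have "\<dots> = mat 1 \<longleftrightarrow> conjugate A B = B"
  proof
    assume "conjugate A B ** conj_transpose B = mat 1"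
    then have "conjugate A B ** (conj_transpose B ** B) = B"
      by (simp add: matrix_mul_assoc)
    then show "conjugate A B = B" using assms by (simp add: U_mats_left)
  qed (simp add: assms U_mats_right)
  finally show ?thesis using assms by (simp add: conjugate_eq_iff_commute)
qed

text \<open>Evaluation at \<open>z\<close> is a ring homomorphism, so it commutes with the Leibniz formula for \<open>det\<close>.
  This reduces the invariance of the characteristic polynomial to that of a complex determinant.\<close>

lemma poly_char_poly: "poly (char_poly A) z = det (mat z - (A :: ('r::finite) cmat))"
proof -
  have eq: "poly ((if i = j then [:0, 1:] else 0) - [:A $ i $ j:]) z = (mat z - A) $ i $ j" for i j
    by (simp add: mat_def)
  have sgn: "poly (of_int k) z = of_int k" for k by simp
  show ?thesis
    unfolding char_poly_def det_def
    by (simp only: poly_sum poly_mult poly_prod sgn eq vec_lambda_beta)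
qed

lemma eigenvalues_conjugate:
  assumes "P \<in> U_mats" shows "eigenvalues (conjugate P A) = eigenvalues A"
proof -
  have "poly (char_poly (conjugate P A)) z = poly (char_poly A) z" for z
  proof -
    have "conjugate P (mat z - A) = conjugate P (mat z) - conjugate P A"
      using assms by (simp add: conjugate_U matrix_eq matrix_vector_mult_diff_rdistrib
          matrix_vector_mult_diff_distrib matrix_vector_mul_assoc[symmetric])
    then show ?thesis
      unfolding poly_char_poly
      using det_conjugate[OF assms, of "mat z - A"] conjugate_scalar[OF assms, of z] by simp
  qed
  then have "char_poly (conjugate P A) = char_poly A" by (simp add: poly_eq_poly_eq_iff[symmetric] fun_eq_iff)
  then show ?thesis by (simp add: eigenvalues_def)
qed

lemma eigenvalues_diag: "eigenvalues (diag m) = entries m"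
proof -
  have "char_poly (diag m) = (\<Prod>i\<in>UNIV. [:- (m $ i), 1:])"
    unfolding char_poly_def by (subst det_diagonal) (auto simp: diag_def)
  then have "eigenvalues (diag m) = (\<Sum>i\<in>UNIV. {#m $ i#})"
    unfolding eigenvalues_def by (simp add: proots_prod)
  also have "\<dots> = entries m"
    unfolding entries_def sum_unfold_sum_mset
    by (induction "mset_set UNIV :: _ multiset") auto
  finally show ?thesis .
qed


section \<open>Diagonalization of unitary matrices\<close>

definition cinner :: "complex^'r \<Rightarrow> complex^('r::finite) \<Rightarrow> complex" where
  "cinner x y = (\<Sum>i\<in>UNIV. cnj (x $ i) * y $ i)"

lemma cinner_mult_left:
  fixes A :: "('r::finite) cmat"
  shows "cinner x (A *v y) = cinner (conj_transpose A *v x) y"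
proof -
  have "cinner x (A *v y) = (\<Sum>i\<in>UNIV. \<Sum>j\<in>UNIV. cnj (x $ i) * (A $ i $ j * y $ j))"
    by (simp add: cinner_def matrix_vector_mult_def sum_distrib_left)
  also have "\<dots> = (\<Sum>j\<in>UNIV. \<Sum>i\<in>UNIV. cnj (x $ i) * (A $ i $ j * y $ j))"
    by (rule sum.swap)
  also have "\<dots> = cinner (conj_transpose A *v x) y"
    by (simp add: cinner_def matrix_vector_mult_def sum_distrib_left sum_distrib_right cnj_sum algebra_simps)
  finally show ?thesis .
qed

lemma cinner_smult: "cinner x (c *s y) = c * cinner x y" "cinner (c *s x) y = cnj c * cinner x y"
  by (simp_all add: cinner_def sum_distrib_left algebra_simps)

lemma cinner_commute: "cinner y x = cnj (cinner x y)"
  by (simp add: cinner_def cnj_sum mult.commute)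

lemma cinner_self: "cinner x x = of_real (\<Sum>i\<in>UNIV. (cmod (x $ i))\<^sup>2)"
  by (simp add: cinner_def complex_norm_square mult.commute del: of_real_power)

lemma ex_unit_multiple:
  assumes "x \<noteq> 0" shows "\<exists>c. cinner (c *s x) (c *s x) = 1 \<and> c \<noteq> 0"
proof -
  define s where "s = (\<Sum>i\<in>UNIV. (cmod (x $ i))\<^sup>2)"
  have "s \<noteq> 0"
    using assms unfolding s_def by (subst sum_nonneg_eq_0_iff) (auto simp: vec_eq_iff)
  moreover have "s \<ge> 0" by (simp add: s_def sum_nonneg)
  ultimately have "s > 0" by simp
  define c where "c = complex_of_real (1 / sqrt s)"
  have "cinner (c *s x) (c *s x) = of_real ((1 / sqrt s) * (1 / sqrt s) * s)"
    unfolding cinner_smult unfolding cinner_self s_def[symmetric]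
    by (simp only: c_def complex_cnj_complex_of_real of_real_mult mult.assoc)
  also have "(1 / sqrt s) * (1 / sqrt s) * s = 1"
    using \<open>s > 0\<close> by simp
  finally show ?thesis using \<open>s > 0\<close> by (auto simp: c_def)
qed

text \<open>Put the conjugates of the vectors \<open>f i\<close>, \<open>i \<in> K\<close>, into the rows of a square matrix.  The row \<open>k\<close>
  is then zero, so the matrix is singular, and the wanted vector is one of its kernel.\<close>

lemma ex_orthogonal_vector:
  fixes f :: "'r::finite \<Rightarrow> complex^'r"
  assumes "k \<notin> K"
  shows "\<exists>x. x \<noteq> 0 \<and> (\<forall>i\<in>K. cinner (f i) x = 0)"
proof -
  define M :: "'r cmat" where "M = (\<chi> i j. if i \<in> K then cnj (f i $ j) else 0)"
  have Mx: "(M *v x) $ i = cinner (f i) x" if "i \<in> K" for i x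
    using that by (simp add: M_def matrix_vector_mult_def cinner_def)
  have "row k M = 0" using assms by (simp add: row_def M_def vec_eq_iff)
  then have "det M = 0" by (rule det_zero_row)
  then have "\<not> (\<exists>B. B ** M = mat 1)"
    by (metis det_I det_mul mult_zero_right zero_neq_one)
  then obtain x where "M *v x = 0" "x \<noteq> 0" unfolding matrix_left_invertible_ker by blast
  then show ?thesis using Mx by (metis zero_index)
qed

text \<open>An eigenvector \<open>x\<close> of a unitary \<open>A\<close> is also one of its adjoint, so \<open>A\<close> preserves the orthogonal
  complement of \<open>x\<close>.\<close>

lemma U_mats_adjoint_eigenvector:
  assumes A: "A \<in> U_mats" and x: "A *v x = c *s x" "cinner x y = 0"
  shows "cinner x (A *v y) = 0"
proof (cases "c = 0")
  case True
  then have "conj_transpose A *v (A *v x) = 0" using x by simp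
  then have "x = 0" by (simp only: matrix_vector_mul_assoc U_mats_left[OF A] matrix_vector_mul_lid)
  then show ?thesis by (simp add: cinner_def)
next
  case False
  have "x = conj_transpose A *v (A *v x)"
    by (simp only: matrix_vector_mul_assoc U_mats_left[OF A] matrix_vector_mul_lid)
  also have "\<dots> = c *s (conj_transpose A *v x)" using x by (simp add: vector_scalar_commute)
  finally have "cinner x y = cnj c * cinner (conj_transpose A *v x) y"
    by (metis cinner_smult(2))
  then show ?thesis using x False by (simp add: cinner_mult_left)
qed

text \<open>Indexing the family by a growing set \<open>K\<close> of matrix indices keeps the induction within the fixed
  space \<open>\<complex>^r\<close>.  In each step, \<open>A\<close> preserves the orthogonal complement of the eigenvectors found so
  far, which is nonzero because \<open>K\<close> is still a proper subset, and so contains a further eigenvector.\<close>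

lemma ex_orthonormal_eigenvectors:
  fixes A :: "('r::finite) cmat" and K :: "'r set"
  assumes A: "A \<in> U_mats"
  shows "\<exists>f \<mu>. (\<forall>i\<in>K. A *v f i = \<mu> i *s f i) \<and>
    (\<forall>i\<in>K. \<forall>j\<in>K. cinner (f i) (f j) = (if i = j then 1 else 0))"
  using finite[of K]
proof (induction K rule: finite_induct)
  case (insert k K)
  then obtain f :: "'r \<Rightarrow> complex^'r" and \<mu> where f: "\<And>i. i \<in> K \<Longrightarrow> A *v f i = \<mu> i *s f i"
    "\<And>i j. i \<in> K \<Longrightarrow> j \<in> K \<Longrightarrow> cinner (f i) (f j) = (if i = j then 1 else 0)"
    by blast
  define W where "W = {x. \<forall>i\<in>K. cinner (f i) x = 0}"
  obtain x where "x \<in> W" "x \<noteq> 0"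
    using ex_orthogonal_vector[OF \<open>k \<notin> K\<close>, of f] by (auto simp: W_def)
  moreover have "vec.subspace W"
    by (auto simp: vec.subspace_def W_def cinner_smult)
       (auto simp: cinner_def sum.distrib distrib_left)
  moreover have "A *v v \<in> W" if "v \<in> W" for v
    using that U_mats_adjoint_eigenvector[OF A f(1)] by (auto simp: W_def)
  ultimately obtain w c where w: "w \<in> W" "w \<noteq> 0" "A *v w = c *s w"
    using ex_eigenvector_in_invariant_subspace by metis
  obtain d where d: "cinner (d *s w) (d *s w) = 1" using ex_unit_multiple[OF w(2)] by blast
  have 1: "cinner (f i) (d *s w) = 0" "cinner (d *s w) (f i) = 0" if "i \<in> K" for i
    using that w(1) cinner_commute[of "d *s w" "f i"] by (auto simp: W_def cinner_smult)
  have 2: "A *v (d *s w) = c *s (d *s w)"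
    using w(3) by (simp add: vector_scalar_commute vector_smult_assoc mult.commute)
  show ?case
    by (rule exI[of _ "f(k := d *s w)"], rule exI[of _ "\<mu>(k := c)"])
      (use insert.hyps(2) f d 1 2 in auto)
qed auto

text \<open>The spectral theorem with prescribed order of the eigenvalues: the matrix \<open>Q\<close> of an orthonormal
  eigenbasis diagonalizes \<open>A\<close> with some order of the eigenvalues, and permuting the columns of \<open>Q\<close>
  brings them into the order of \<open>m\<close>.\<close>

lemma U_mats_diagonalizable:
  fixes A :: "('r::finite) cmat"
  assumes A: "A \<in> U_mats" and m: "entries m = eigenvalues A"
  shows "\<exists>P\<in>SU_mats. A = conjugate P (diag m)"
proof -
  obtain f :: "'r \<Rightarrow> complex^'r" and \<mu> where f: "\<And>i. A *v f i = \<mu> i *s f i"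
    "\<And>i j. cinner (f i) (f j) = (if i = j then 1 else 0)"
    using ex_orthonormal_eigenvectors[OF A, of UNIV] by auto
  define Q :: "'r cmat" where "Q = (\<chi> i j. f j $ i)"
  have Q: "Q \<in> U_mats"
    by (rule U_matsI)
      (use f(2) in \<open>auto simp: vec_eq_iff mat_mult_component Q_def cinner_def mat_def\<close>)
  have "Q ** diag (\<chi> i. \<mu> i) = A ** Q"
  proof -
    have "(A ** Q) $ i $ j = (A *v f j) $ i" for i j
      by (simp add: mat_mult_component matrix_vector_mult_def Q_def)
    then show ?thesis by (simp add: vec_eq_iff mult_diag_component f(1)) (simp add: Q_def mult.commute)
  qed
  then have AQ: "A = conjugate Q (diag (\<chi> i. \<mu> i))" using Q by (simp add: conjugate_eq_iff_commute[symmetric])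
  then have "entries m = entries (\<chi> i. \<mu> i)" using m Q by (simp add: eigenvalues_conjugate eigenvalues_diag)
  then have "image_mset (($) m) (mset_set UNIV) = image_mset \<mu> (mset_set UNIV)"
    by (simp add: entries_def vec_lambda_inverse)
  then obtain \<pi> where \<pi>: "\<pi> permutes UNIV" "\<And>i. m $ i = \<mu> (\<pi> i)"
    using image_mset_eq_implies_permutes[of UNIV "($) m" \<mu>] by (metis UNIV_I finite)
  \<comment> \<open>\<open>Q\<close> with its columns reordered, so that \<open>m\<close> lists the eigenvalues.\<close>
  define R :: "'r cmat" where "R = (\<chi> i j. Q $ i $ \<pi> j)"
  have R: "R \<in> U_mats"
  proof (rule U_matsI)
    have "(conj_transpose R ** R) $ i $ j = (conj_transpose Q ** Q) $ \<pi> i $ \<pi> j" for i j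
      by (simp add: mat_mult_component R_def)
    then show "conj_transpose R ** R = mat 1"
      using permutes_inj[OF \<pi>(1)] by (simp add: U_mats_left[OF Q] vec_eq_iff) (auto simp: mat_def inj_eq)
  qed
  have "R ** diag m = A ** R"
  proof -
    have "(R ** diag m) $ i $ j = (Q ** diag (\<chi> i. \<mu> i)) $ i $ \<pi> j" for i j
      by (simp add: mult_diag_component R_def \<pi>)
    moreover have "(A ** R) $ i $ j = (A ** Q) $ i $ \<pi> j" for i j
      by (simp add: mat_mult_component R_def)
    ultimately show ?thesis
      using \<open>Q ** diag (\<chi> i. \<mu> i) = A ** Q\<close> by (simp add: vec_eq_iff)
  qed
  then have "conjugate R (diag m) = A" using R by (simp add: conjugate_eq_iff_commute)
  then show ?thesis using ex_SU_same_conjugation[OF R] by metis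
qed


section \<open>Irreducibility\<close>

lemma irreducible_pair_conjugate_imp:
  assumes P: "P \<in> U_mats" and irr: "irreducible_pair A B"
  shows "irreducible_pair (conjugate P A) (conjugate P B)"
  unfolding irreducible_pair_def
proof (intro allI impI)
  fix W assume W: "vec.subspace W \<and> (\<forall>v\<in>W. conjugate P A *v v \<in> W) \<and> (\<forall>v\<in>W. conjugate P B *v v \<in> W)"
  \<comment> \<open>The preimage of \<open>W\<close> under \<open>P\<close> is invariant under the original pair.\<close>
  let ?V = "{v. P *v v \<in> W}"
  have inv: "P *v (C *v v) = conjugate P C *v (P *v v)" for C v
    using conjugate_eq_iff_commute[OF P, of C "conjugate P C"] by (simp add: matrix_vector_mul_assoc)
  have PP: "P *v (conj_transpose P *v v) = v" for v
    by (simp only: matrix_vector_mul_assoc U_mats_right[OF P] matrix_vector_mul_lid)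
  have "vec.subspace ?V"
    using W by (auto simp: vec.subspace_def matrix_vector_right_distrib vector_scalar_commute)
  moreover have "\<forall>v\<in>?V. A *v v \<in> ?V" "\<forall>v\<in>?V. B *v v \<in> ?V"
    using W by (auto simp: inv)
  ultimately have "?V = {0} \<or> ?V = UNIV" using irr unfolding irreducible_pair_def by blast
  then show "W = {0} \<or> W = UNIV"
  proof
    assume V: "?V = {0}"
    have "v = 0" if "v \<in> W" for v
    proof -
      have "conj_transpose P *v v \<in> ?V" using that by (simp add: PP)
      then have "conj_transpose P *v v = 0" using V by blast
      then show ?thesis using PP[of v] by simp
    qed
    then show ?thesis using W vec.subspace_0 by blast
  next
    assume V: "?V = UNIV"
    have "v \<in> W" for v
    proof -
      have "conj_transpose P *v v \<in> ?V" using V by blast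
      then show ?thesis by (simp add: PP)
    qed
    then show ?thesis by blast
  qed
qed

lemma irreducible_pair_conjugate:
  assumes P: "P \<in> U_mats"
  shows "irreducible_pair (conjugate P A) (conjugate P B) \<longleftrightarrow> irreducible_pair A B"
  using irreducible_pair_conjugate_imp[OF P, of A B]
    irreducible_pair_conjugate_imp[OF U_mats_conj_transpose[OF P], of "conjugate P A" "conjugate P B"]
  by (auto simp: conjugate_inverse[OF P])

text \<open>Schur's lemma: some eigenspace of \<open>C\<close> is nonzero, and it is invariant under every matrix that commutes
  with \<open>C\<close>, so it is the whole space.\<close>

lemma irreducible_pair_schur:
  assumes irr: "irreducible_pair A B" and comm: "C ** A = A ** C" "C ** B = B ** C"
  shows "\<exists>c. C = mat c"
proof -
  have "\<exists>w c. w \<in> UNIV \<and> w \<noteq> 0 \<and> C *v w = c *s w"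
    by (rule ex_eigenvector_in_invariant_subspace[of _ _ 1]) (auto simp: vec_eq_iff)
  then obtain w c where w: "w \<noteq> 0" "C *v w = c *s w" by blast
  let ?W = "{v. C *v v = c *s v}"
  have "vec.subspace ?W"
    by (auto simp: vec.subspace_def matrix_vector_right_distrib vector_scalar_commute
        vector_add_ldistrib vector_smult_assoc mult.commute)
  moreover have "D *v v \<in> ?W" if "v \<in> ?W" "C ** D = D ** C" for D v
  proof -
    have "C *v (D *v v) = D *v (C *v v)" unfolding matrix_vector_mul_assoc that(2) ..
    then show ?thesis using that(1) by (simp add: vector_scalar_commute)
  qed
  ultimately have "?W = {0} \<or> ?W = UNIV"
    using irr comm unfolding irreducible_pair_def by blast
  then have "?W = UNIV" using w by blast
  then have "C = mat c" unfolding matrix_eq mat_mult_vec by blast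
  then show ?thesis by blast
qed


section \<open>Diagonal matrices with the same coincidences\<close>

lemma poly_interpolation:
  fixes g :: "'a::field \<Rightarrow> 'a"
  assumes "finite S"
  shows "\<exists>p. \<forall>x\<in>S. poly p x = g x"
  using assms
proof (induction S rule: finite_induct)
  case (insert y S)
  then obtain p where p: "\<And>x. x \<in> S \<Longrightarrow> poly p x = g x" by blast
  \<comment> \<open>The Newton step: correct \<open>p\<close> by a multiple of the polynomial that vanishes on \<open>S\<close>.\<close>
  let ?v = "\<Prod>s\<in>S. [:- s, 1:]"
  have nz: "poly ?v y \<noteq> 0" using insert.hyps by (auto simp: poly_prod)
  have z: "poly ?v x = 0" if "x \<in> S" for x
    using that insert.hyps by (auto simp: poly_prod prod_zero_iff)
  have "\<forall>x\<in>insert y S. poly (p + smult ((g y - poly p y) / poly ?v y) ?v) x = g x"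
    using nz z p by auto
  then show ?case by blast
qed auto

text \<open>On the finite set of entries of \<open>l\<close>, the function \<open>g\<close> agrees with a polynomial \<open>p\<close>; so
  \<open>diag (g \<circ> l) = p(diag l)\<close>, which preserves every subspace that \<open>diag l\<close> preserves.\<close>

lemma invariant_subspace_diag_comp:
  fixes l :: "complex^('r::finite)"
  assumes W: "vec.subspace W" "\<forall>v\<in>W. diag l *v v \<in> W" and v: "v \<in> W"
  shows "diag (\<chi> i. g (l $ i)) *v v \<in> W"
proof -
  obtain p where p: "\<And>i. poly p (l $ i) = g (l $ i)"
    using poly_interpolation[of "range (($) l)" g] by auto
  have "diag (\<chi> i. poly p (l $ i)) *v v \<in> W" for p
  proof (induction p)
    case 0
    have "diag (\<chi> i. poly 0 (l $ i)) *v v = 0" by (simp add: diag_mult_vec vec_eq_iff)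
    then show ?case using W(1) vec.subspace_0 by metis
  next
    case (pCons a p)
    have "diag (\<chi> i. poly (pCons a p) (l $ i)) *v v
        = a *s v + diag l *v (diag (\<chi> i. poly p (l $ i)) *v v)"
      by (simp add: diag_mult_vec vec_eq_iff algebra_simps)
    then show ?case using W v pCons.IH by (metis vec.subspace_add vec.subspace_scale)
  qed
  from this[of p] show ?thesis by (simp add: p)
qed

lemma irreducible_pair_diag_same_kernel_imp:
  fixes l m :: "complex^('r::finite)"
  assumes ker: "\<And>i j. m $ i = m $ j \<Longrightarrow> l $ i = l $ j"
    and irr: "irreducible_pair (diag l) B"
  shows "irreducible_pair (diag m) B"
  unfolding irreducible_pair_def
proof (intro allI impI, elim conjE)
  fix W assume W: "vec.subspace W" "\<forall>v\<in>W. diag m *v v \<in> W" "\<forall>v\<in>W. B *v v \<in> W"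
  \<comment> \<open>By \<open>ker\<close>, the entries of \<open>l\<close> are a function of those of \<open>m\<close>.\<close>
  define g where "g z = l $ (SOME i. m $ i = z)" for z
  have "g (m $ i) = l $ i" for i
    unfolding g_def by (rule ker) (rule someI[of _ i], simp)
  then have "(\<chi> i. g (m $ i)) = l" by (simp add: vec_eq_iff)
  then have "\<forall>v\<in>W. diag l *v v \<in> W"
    using invariant_subspace_diag_comp[OF W(1,2), of _ g] by simp
  then show "W = {0} \<or> W = UNIV" using irr W unfolding irreducible_pair_def by blast
qed

lemma irreducible_pair_diag_same_kernel:
  fixes l m :: "complex^('r::finite)"
  assumes "\<And>i j. m $ i = m $ j \<longleftrightarrow> l $ i = l $ j"
  shows "irreducible_pair (diag m) B \<longleftrightarrow> irreducible_pair (diag l) B"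
  using assms irreducible_pair_diag_same_kernel_imp by metis

text \<open>Entrywise, \<open>P diag(l) = diag(l) P\<close> reads \<open>P_ij l_j = l_i P_ij\<close>; only the coincidences among the
  entries of \<open>l\<close> enter.\<close>

lemma Stab_iff:
  "P \<in> Stab l \<longleftrightarrow> P \<in> U_mats \<and> (\<forall>i j. P $ i $ j = 0 \<or> l $ i = l $ j)"
proof -
  have "P ** diag l = diag l ** P \<longleftrightarrow> (\<forall>i j. P $ i $ j * l $ j = l $ i * P $ i $ j)"
    by (simp only: vec_eq_iff diag_mult_component mult_diag_component)
  also have "\<dots> \<longleftrightarrow> (\<forall>i j. P $ i $ j = 0 \<or> l $ i = l $ j)"
    by (simp add: mult.commute[of "l $ _"]) metis
  finally show ?thesis by (auto simp: Stab_def conjugate_eq_iff_commute)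
qed

lemma Stab_same_kernel:
  assumes "\<And>i j. m $ i = m $ j \<longleftrightarrow> l $ i = l $ j"
  shows "Stab m = Stab l"
  using assms by (auto simp: Stab_iff)


section \<open>Conjugacy classes\<close>

lemma Stab_U: "P \<in> Stab l \<Longrightarrow> P \<in> U_mats"
  by (simp add: Stab_def)

lemma Stab_mat_1: "mat 1 \<in> Stab l"
  by (simp add: Stab_def U_mats_mat_1)

lemma Stab_mult: "P \<in> Stab l \<Longrightarrow> Q \<in> Stab l \<Longrightarrow> P ** Q \<in> Stab l"
  by (auto simp: Stab_def U_mats_mult conjugate_conjugate[symmetric])

lemma Stab_conj_transpose: "P \<in> Stab l \<Longrightarrow> conj_transpose P \<in> Stab l"
  by (auto simp: Stab_iff U_mats_conj_transpose) metis

text \<open>The classes are the orbits of a group action, so two of them are equal as soon as one contains a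
  point of the other.\<close>

lemma Stab_class_eq_iff: "Stab_class l A = Stab_class l B \<longleftrightarrow> (\<exists>P\<in>Stab l. conjugate P A = B)"
proof
  assume eq: "Stab_class l A = Stab_class l B"
  have "B \<in> Stab_class l B"
    unfolding Stab_class_def by (intro CollectI exI[of _ "mat 1"]) (simp add: Stab_mat_1)
  then have "B \<in> Stab_class l A" by (simp only: eq)
  then show "\<exists>P\<in>Stab l. conjugate P A = B" by (auto simp: Stab_class_def)
next
  assume "\<exists>P\<in>Stab l. conjugate P A = B"
  then obtain P where P: "P \<in> Stab l" "B = conjugate P A" by blast
  have "conjugate Q A = conjugate (Q ** conj_transpose P) B" if "Q \<in> Stab l" for Q
    using that P
    by (simp add: conjugate_conjugate[symmetric] Stab_U U_mats_conj_transpose conjugate_inverse)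
  then have "Stab_class l A \<subseteq> Stab_class l B"
    unfolding Stab_class_def using P(1) Stab_mult Stab_conj_transpose by blast
  moreover have "conjugate Q B = conjugate (Q ** P) A" if "Q \<in> Stab l" for Q
    using that P by (simp add: conjugate_conjugate Stab_U)
  then have "Stab_class l B \<subseteq> Stab_class l A"
    unfolding Stab_class_def using P(1) Stab_mult by blast
  ultimately show "Stab_class l A = Stab_class l B" by blast
qed

lemma rep_class_eq_iff:
  "rep_class \<rho> = rep_class \<rho>' \<longleftrightarrow>
    (\<exists>P\<in>SU_mats. (conjugate P (fst \<rho>), conjugate P (snd \<rho>)) = \<rho>')"
proof
  assume eq: "rep_class \<rho> = rep_class \<rho>'"
  have "\<rho>' \<in> rep_class \<rho>'"
    unfolding rep_class_def by (intro CollectI exI[of _ "mat 1"]) (simp add: SU_mats_mat_1)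
  then have "\<rho>' \<in> rep_class \<rho>" by (simp only: eq)
  then show "\<exists>P\<in>SU_mats. (conjugate P (fst \<rho>), conjugate P (snd \<rho>)) = \<rho>'"
    by (auto simp: rep_class_def)
next
  assume "\<exists>P\<in>SU_mats. (conjugate P (fst \<rho>), conjugate P (snd \<rho>)) = \<rho>'"
  then obtain P where P: "P \<in> SU_mats" "\<rho>' = (conjugate P (fst \<rho>), conjugate P (snd \<rho>))" by auto
  have "conjugate Q A = conjugate (Q ** conj_transpose P) (conjugate P A)" if "Q \<in> SU_mats" for Q A
    using that P(1)
    by (simp add: conjugate_conjugate[symmetric] SU_mats_imp_U U_mats_conj_transpose conjugate_inverse)
  then have "rep_class \<rho> \<subseteq> rep_class \<rho>'"
    unfolding rep_class_def P(2) fst_conv snd_conv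
    using P(1) SU_mats_mult SU_mats_conj_transpose by blast
  moreover have "conjugate Q (conjugate P A) = conjugate (Q ** P) A" if "Q \<in> SU_mats" for Q A
    using that P by (simp add: conjugate_conjugate SU_mats_imp_U)
  then have "rep_class \<rho>' \<subseteq> rep_class \<rho>"
    unfolding rep_class_def P(2) fst_conv snd_conv using P(1) SU_mats_mult by blast
  ultimately show "rep_class \<rho> = rep_class \<rho>'" by blast
qed


section \<open>Unordered tuples of a given type\<close>

text \<open>The definition of \<open>Sym \<sigma>\<close> fixes the number of values of multiplicity \<open>k\<close> only for the parts \<open>k\<close> of
  \<open>\<sigma>\<close>.  These values already account for \<open>\<Sum> a_i r_i = r\<close> elements, counted with multiplicity, which leaves
  no room for a value of any other multiplicity.\<close>

lemma Sym_count_in_partition: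
  assumes M: "M \<in> Sym \<sigma>" and z: "z \<in># M"
  shows "count M z \<in> set \<sigma>"
proof (rule ccontr)
  assume nz: "count M z \<notin> set \<sigma>"
  let ?T = "{z \<in> set_mset M. count M z \<in> set \<sigma>}"
  have "sum (count M) ?T = (\<Sum>k\<in>set \<sigma>. \<Sum>z\<in>{z\<in>?T. count M z = k}. count M z)"
    by (intro sum.group[symmetric]) auto
  also have "\<dots> = (\<Sum>k\<in>set \<sigma>. count_list \<sigma> k * k)"
  proof (rule sum.cong)
    fix k assume k: "k \<in> set \<sigma>"
    then have "{z\<in>?T. count M z = k} = {z \<in> set_mset M. count M z = k}" by auto
    then show "(\<Sum>z\<in>{z\<in>?T. count M z = k}. count M z) = count_list \<sigma> k * k"
      using M k by (simp add: Sym_def)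
  qed simp
  also have "\<dots> = sum_list (map (\<lambda>k. k) \<sigma>)"
    by (rule sum_list_map_eq_sum_count[symmetric])
  also have "\<dots> = size M" using M by (simp add: Sym_def)
  also have "\<dots> = sum (count M) (set_mset M)" by (simp add: size_multiset_overloaded_eq)
  also have "\<dots> \<ge> sum (count M) (insert z ?T)" using z by (intro sum_mono2) auto
  finally show False using nz z by (auto simp: count_eq_zero_iff)
qed

text \<open>For each \<open>k\<close>, the tuples \<open>L\<close> and \<open>M\<close> have equally many values of multiplicity \<open>k\<close>; match these
  values by bijections.\<close>

lemma Sym_same_multiplicities:
  assumes L: "L \<in> Sym \<sigma>" and M: "M \<in> Sym \<sigma>"
  shows "\<exists>f. inj_on f (set_mset L) \<and> image_mset f L = M"
proof -
  let ?S = "\<lambda>M k. {z \<in> set_mset M. count M z = k}"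
  have "\<exists>h. bij_betw h (?S L k) (?S M k)" for k
  proof (rule finite_same_card_bij)
    show "card (?S L k) = card (?S M k)"
    proof (cases "k \<in> set \<sigma>")
      case True
      then show ?thesis using L M by (simp add: Sym_def)
    next
      case False
      then have e: "?S L k = {}" "?S M k = {}"
        using Sym_count_in_partition[OF L] Sym_count_in_partition[OF M] by auto
      show ?thesis unfolding e ..
    qed
  qed auto
  then obtain h where h: "\<And>k. bij_betw (h k) (?S L k) (?S M k)" by metis
  define f where "f z = h (count L z) z" for z
  have f: "f z \<in># M" "count M (f z) = count L z" if "z \<in># L" for z
    using bij_betwE[OF h, of "count L z"] that by (auto simp: f_def)
  have inj: "inj_on f (set_mset L)"
  proof (rule inj_onI)
    fix y z assume yz: "y \<in># L" "z \<in># L" "f y = f z"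
    then have "count L y = count L z" using f by metis
    then show "y = z"
      using yz bij_betw_imp_inj_on[OF h, of "count L z"] by (auto simp: f_def inj_on_def)
  qed
  have "count (image_mset f L) y = count M y" for y
  proof (cases "y \<in># M")
    case True
    then have "y \<in> h (count M y) ` ?S L (count M y)"
      using bij_betw_imp_surj_on[OF h, of "count M y"] by auto
    then obtain z where z: "z \<in># L" "f z = y" by (auto simp: f_def)
    then have "f -` {y} \<inter> set_mset L = {z}" using inj by (auto simp: inj_on_def)
    then show ?thesis using f(2)[OF z(1)] z by (simp add: count_image_mset)
  next
    case False
    then have "f -` {y} \<inter> set_mset L = {}" using f(1) by auto
    then show ?thesis using False by (simp add: count_image_mset not_in_iff)
  qed
  then show ?thesis using inj by (intro exI[of _ f]) (simp add: multiset_eq_iff)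
qed

lemma set_mset_entries [simp]: "set_mset (entries l) = range (($) l)"
  by (simp add: entries_def)

text \<open>Apply the matching of values to the entries of \<open>l\<close>.\<close>

lemma ex_vector_same_kernel:
  fixes l :: "complex^('r::finite)"
  assumes "entries l \<in> Sym \<sigma>" "M \<in> Sym \<sigma>"
  shows "\<exists>m :: complex^'r. entries m = M \<and> (\<forall>i j. m $ i = m $ j \<longleftrightarrow> l $ i = l $ j)"
proof -
  obtain f where f: "inj_on f (range (($) l))" "image_mset f (entries l) = M"
    using Sym_same_multiplicities[OF assms] by auto
  have "entries (\<chi> i. f (l $ i)) = image_mset f (entries l)"
    by (simp add: entries_def multiset.map_comp comp_def vec_lambda_inverse)
  then show ?thesis using f by (intro exI[of _ "\<chi> i. f (l $ i)"]) (auto simp: inj_on_eq_iff)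
qed


section \<open>Spectra of irreducible representations\<close>

lemma prod_mset_entries: "prod_mset (entries m) = (\<Prod>i\<in>UNIV. m $ i)"
  by (simp add: entries_def prod_unfold_prod_mset)

lemma irr_reps_diag:
  fixes m :: "complex^('r::finite)"
  assumes M: "entries m \<in> SSym_roots n \<sigma>" and B: "B \<in> SU_mats" "irreducible_pair (diag m) B"
  shows "(diag m, B) \<in> irr_reps n"
proof -
  have "set_mset (entries m) \<subseteq> sphere 0 1" "prod_mset (entries m) = 1"
    using M by (auto simp: SSym_roots_def SSym_def Sym_def)
  then have D: "diag m \<in> SU_mats"
    by (auto simp: SU_mats_def det_diag prod_mset_entries subset_iff intro!: U_mats_diag)
  obtain \<omega> where "\<And>i. m $ i ^ n = \<omega>" using M by (auto simp: SSym_roots_def)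
  then have "mat_pow (diag m) n = mat \<omega>" by (simp add: mat_pow_diag) (simp add: vec_eq_iff diag_def mat_def)
  then have "mat_pow (diag m) n ** B = B ** mat_pow (diag m) n"
    by (simp only: mat_scalar_commute[of B])
  then have "commutator (mat_pow (diag m) n) B = mat 1"
    using D B by (simp add: commutator_eq_1_iff mat_pow_U SU_mats_imp_U)
  then show ?thesis using D B by (simp add: irr_reps_def)
qed

lemma irr_reps_conjugate:
  assumes P: "P \<in> SU_mats" and AB: "(A, B) \<in> irr_reps n"
  shows "(conjugate P A, conjugate P B) \<in> irr_reps n"
proof -
  have U: "P \<in> U_mats" "A \<in> U_mats" "B \<in> U_mats"
    using AB P by (auto simp: irr_reps_def SU_mats_imp_U)
  then have "mat_pow A n ** B = B ** mat_pow A n"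
    using AB by (simp add: irr_reps_def commutator_eq_1_iff mat_pow_U)
  then have "conjugate P (mat_pow A n) ** conjugate P B = conjugate P B ** conjugate P (mat_pow A n)"
    using U by (simp add: conjugate_mult[symmetric])
  then have "commutator (mat_pow (conjugate P A) n) (conjugate P B) = mat 1"
    using U by (simp add: commutator_eq_1_iff mat_pow_U U_mats_conjugate mat_pow_conjugate)
  then show ?thesis
    using AB U by (simp add: irr_reps_def SU_mats_conjugate irreducible_pair_conjugate)
qed

text \<open>This is where irreducibility makes the spectrum discrete: \<open>A^n\<close> commutes with \<open>A\<close> and \<open>B\<close>, so it is a
  scalar, and its determinant \<open>\<omega>^r\<close> is \<open>(det A)^n = 1\<close>.\<close>

lemma eigenvalues_irr_rep:
  fixes A :: "('r::finite) cmat"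
  assumes AB: "(A, B) \<in> irr_reps n" and A: "A = conjugate P (diag m)" "P \<in> U_mats"
  shows "\<exists>\<omega>. \<omega> ^ CARD('r) = 1 \<and> (\<forall>i. m $ i ^ n = \<omega>)"
proof -
  have U: "A \<in> U_mats" "B \<in> U_mats" and det: "det A = 1"
    using AB by (auto simp: irr_reps_def SU_mats_def)
  then have "mat_pow A n ** B = B ** mat_pow A n"
    using AB by (simp add: irr_reps_def commutator_eq_1_iff mat_pow_U)
  then obtain \<omega> where \<omega>: "mat_pow A n = mat \<omega>"
    using AB irreducible_pair_schur[of A B "mat_pow A n"] mat_pow_commute[of A n]
    by (auto simp: irr_reps_def)
  have "\<omega> ^ CARD('r) = 1"
    using det_mat_pow[of A n] det by (simp add: \<omega> det_mat_scalar)
  moreover have "mat_pow (diag m) n = conjugate (conj_transpose P) (mat_pow A n)"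
    using A by (simp add: mat_pow_conjugate conjugate_inverse)
  then have "diag (\<chi> i. m $ i ^ n) = mat \<omega>"
    using A(2) by (simp add: mat_pow_diag \<omega> conjugate_scalar U_mats_conj_transpose)
  have "m $ i ^ n = \<omega>" for i
    using arg_cong[OF \<open>diag _ = mat \<omega>\<close>, of "\<lambda>M. M $ i $ i"] by (simp add: diag_def mat_def)
  ultimately show ?thesis by blast
qed


section \<open>Quotient maps\<close>

lemma quotient_maps_same_fibres_homeomorphic:
  assumes f: "quotient_map X Y f" and g: "quotient_map X Z g"
    and fib: "\<And>x y. x \<in> topspace X \<Longrightarrow> y \<in> topspace X \<Longrightarrow> f x = f y \<longleftrightarrow> g x = g y"
  shows "Y homeomorphic_space Z"
proof -
  obtain h where h: "continuous_map Y Z h" "\<And>x. x \<in> topspace X \<Longrightarrow> h (f x) = g x"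
    using quotient_map_lift_exists[OF f quotient_imp_continuous_map[OF g]] fib by metis
  obtain k where k: "continuous_map Z Y k" "\<And>x. x \<in> topspace X \<Longrightarrow> k (g x) = f x"
    using quotient_map_lift_exists[OF g quotient_imp_continuous_map[OF f]] fib by metis
  have "homeomorphic_maps Y Z h k"
    unfolding homeomorphic_maps_def
    unfolding quotient_imp_surjective_map[OF f, symmetric] quotient_imp_surjective_map[OF g, symmetric]
    using h k by auto
  then show ?thesis unfolding homeomorphic_space_def by blast
qed

text \<open>A quotient map need not restrict to a quotient map on a saturated subspace that is neither open nor
  closed, but open maps restrict to open maps on any saturated subspace.\<close>

lemma quotient_map_restrict_saturated:
  assumes f: "quotient_map X Y f" and op: "open_map X Y f" and U: "{x \<in> topspace X. f x \<in> V} = U"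
  shows "quotient_map (subtopology X U) (subtopology Y V) f"
proof (rule continuous_open_imp_quotient_map)
  show "continuous_map (subtopology X U) (subtopology Y V) f"
    using U quotient_imp_continuous_map[OF f]
    by (auto simp: continuous_map_in_subtopology continuous_map_from_subtopology)
  show "open_map (subtopology X U) (subtopology Y V) f"
    using op U by (rule open_map_restriction)
  show "f ` topspace (subtopology X U) = topspace (subtopology Y V)"
    using U quotient_imp_surjective_map[OF f] by (auto simp: topspace_subtopology)
qed

text \<open>The saturation of an open set \<open>U\<close> is the union of the preimages of \<open>U\<close> under the group elements.\<close>

lemma orbit_map_open:
  assumes cont: "\<And>a. a \<in> G \<Longrightarrow> continuous_map X X (act a)"
    and orb: "\<And>x y. x \<in> topspace X \<Longrightarrow> y \<in> topspace X \<Longrightarrow> q x = q y \<longleftrightarrow> (\<exists>a\<in>G. act a x = y)"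
  shows "open_map X (quotient_topology X q) q"
  unfolding open_map_def openin_quotient_topology
proof (intro allI impI conjI)
  fix U assume U: "openin X U"
  then have sub: "U \<subseteq> topspace X" by (rule openin_subset)
  then show "q ` U \<subseteq> q ` topspace X" by blast
  have "{x \<in> topspace X. q x \<in> q ` U} = (\<Union>a\<in>G. {x \<in> topspace X. act a x \<in> U})"
    (is "?L = ?R")
  proof (intro set_eqI)
    fix x
    have "x \<in> ?L \<longleftrightarrow> x \<in> topspace X \<and> (\<exists>y\<in>U. q x = q y)" by auto
    also have "\<dots> \<longleftrightarrow> x \<in> topspace X \<and> (\<exists>y\<in>U. \<exists>a\<in>G. act a x = y)"
      using orb sub by blast
    also have "\<dots> \<longleftrightarrow> x \<in> ?R" by auto
    finally show "x \<in> ?L \<longleftrightarrow> x \<in> ?R" .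
  qed
  then show "openin X {x \<in> topspace X. q x \<in> q ` U}"
    using openin_continuous_map_preimage[OF cont U] by auto
qed

lemma openin_discrete_times_iff:
  fixes I :: "'a::discrete_topology set" and F :: "'b::topological_space set"
  assumes "S \<subseteq> I \<times> F"
  shows "openin (top_of_set (I \<times> F)) S \<longleftrightarrow> (\<forall>i\<in>I. openin (top_of_set F) {x. (i, x) \<in> S})"
proof
  assume S: "openin (top_of_set (I \<times> F)) S"
  show "\<forall>i\<in>I. openin (top_of_set F) {x. (i, x) \<in> S}"
  proof
    fix i assume i: "i \<in> I"
    have "continuous_map (top_of_set F) (top_of_set (I \<times> F)) (Pair i)"
      using i by (auto intro!: continuous_intros)
    from openin_continuous_map_preimage[OF this S]
    show "openin (top_of_set F) {x. (i, x) \<in> S}"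
      using assms by (auto elim!: back_subst[where P = "openin (top_of_set F)"])
  qed
next
  assume S: "\<forall>i\<in>I. openin (top_of_set F) {x. (i, x) \<in> S}"
  have "openin (top_of_set (I \<times> F)) ({i} \<times> {x. (i, x) \<in> S})" if "i \<in> I" for i
  proof (rule openin_Times)
    show "openin (top_of_set I) {i}"
      using that by (auto intro!: open_subset open_discrete)
  qed (use S that in blast)
  then have "openin (top_of_set (I \<times> F)) (\<Union>i\<in>I. {i} \<times> {x. (i, x) \<in> S})" by blast
  also have "(\<Union>i\<in>I. {i} \<times> {x. (i, x) \<in> S}) = S" using assms by auto
  finally show "openin (top_of_set (I \<times> F)) S" .
qed

text \<open>On a product with a discrete factor, openness is decided slice by slice, exactly as in the sum
  topology.\<close>

lemma quotient_map_to_sum_of_copies: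
  fixes I :: "'a::discrete_topology set" and F :: "'b::topological_space set"
  assumes q: "quotient_map (top_of_set F) Y q"
  shows "quotient_map (top_of_set (I \<times> F)) (sum_topology (\<lambda>_. Y) I) (\<lambda>(i, x). (i, q x))"
  unfolding quotient_map_def
proof (intro conjI allI impI)
  have qF: "q ` F = topspace Y" using quotient_imp_surjective_map[OF q] by simp
  show "(\<lambda>(i, x). (i, q x)) ` topspace (top_of_set (I \<times> F)) = topspace (sum_topology (\<lambda>_. Y) I)"
    using qF by force
  fix U assume U: "U \<subseteq> topspace (sum_topology (\<lambda>_. Y) I)"
  let ?S = "{x \<in> topspace (top_of_set (I \<times> F)). (case x of (i, x) \<Rightarrow> (i, q x)) \<in> U}"
  have "openin (top_of_set (I \<times> F)) ?S \<longleftrightarrow> (\<forall>i\<in>I. openin (top_of_set F) {x. (i, x) \<in> ?S})"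
    by (rule openin_discrete_times_iff) auto
  also have "\<dots> \<longleftrightarrow> (\<forall>i\<in>I. openin Y {y. (i, y) \<in> U})"
  proof (rule ball_cong)
    fix i assume i: "i \<in> I"
    have "{x. (i, x) \<in> ?S} = {x \<in> topspace (top_of_set F). q x \<in> {y. (i, y) \<in> U}}"
      using i by auto
    moreover have "{y. (i, y) \<in> U} \<subseteq> topspace Y" using U by auto
    then have "openin (top_of_set F) {x \<in> topspace (top_of_set F). q x \<in> {y. (i, y) \<in> U}}
        \<longleftrightarrow> openin Y {y. (i, y) \<in> U}"
      using q unfolding quotient_map_def by blast
    ultimately show "openin (top_of_set F) {x. (i, x) \<in> ?S} \<longleftrightarrow> openin Y {y. (i, y) \<in> U}"
      by simp
  qed simp
  also have "\<dots> \<longleftrightarrow> openin (sum_topology (\<lambda>_. Y) I) U"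
    using U by (simp add: openin_sum_topology comp_def)
  finally show "openin (top_of_set (I \<times> F)) ?S \<longleftrightarrow> openin (sum_topology (\<lambda>_. Y) I) U" .
qed

text \<open>A continuous map from a compact to a Hausdorff space is closed, and closedness survives the
  restriction to the full preimage of any subset \<open>R\<close> of the target, however far from closed \<open>R\<close> is.
  This takes the place of a continuous local choice of diagonalizations.\<close>

lemma compact_map_restrict_quotient:
  fixes h :: "'a::topological_space \<Rightarrow> 'b::metric_space"
  assumes "compact S" "continuous_on S h" "h ` {x \<in> S. h x \<in> R} = R"
  shows "quotient_map (top_of_set {x \<in> S. h x \<in> R}) (top_of_set R) h"
proof -
  let ?K = "{x \<in> S. h x \<in> R}"
  have K: "top_of_set ?K = subtopology (top_of_set S) ?K"
    by (simp add: subtopology_subtopology) (metis (no_types, lifting) Int_absorb1 mem_Collect_eq subsetI)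
  have "closed_map (top_of_set S) euclidean h"
    using assms by (intro continuous_imp_closed_map) (auto simp: compact_space_subtopology)
  then have "closed_map (top_of_set ?K) (top_of_set R) h"
    unfolding K by (rule closed_map_restriction) auto
  then show ?thesis
    by (rule continuous_closed_imp_quotient_map[rotated])
      (use assms continuous_on_subset[OF assms(2), of ?K] in auto)
qed


section \<open>Topology of the representation spaces\<close>

lemma continuous_on_matrix_mult [continuous_intros]:
  fixes f g :: "'a::topological_space \<Rightarrow> ('r::finite) cmat"
  assumes "continuous_on S f" "continuous_on S g"
  shows "continuous_on S (\<lambda>x. f x ** g x)"
  unfolding matrix_matrix_mult_def using assms by (intro continuous_intros)

lemma continuous_on_conj_transpose [continuous_intros]:
  fixes f :: "'a::topological_space \<Rightarrow> ('r::finite) cmat"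
  assumes "continuous_on S f"
  shows "continuous_on S (\<lambda>x. conj_transpose (f x))"
  unfolding conj_transpose_def using assms by (intro continuous_intros)

lemma continuous_on_det [continuous_intros]:
  fixes f :: "'a::topological_space \<Rightarrow> ('r::finite) cmat"
  assumes "continuous_on S f"
  shows "continuous_on S (\<lambda>x. det (f x))"
  unfolding det_def using assms by (intro continuous_intros)

lemma continuous_on_fst_discrete:
  fixes c :: "'a::discrete_topology \<Rightarrow> 'b::topological_space"
  shows "continuous_on S (\<lambda>x. c (fst x))"
  by (rule continuous_on_compose2[of UNIV c]) (auto intro: continuous_intros)

lemma continuous_on_conjugate:
  fixes f :: "'a::topological_space \<Rightarrow> ('r::finite) cmat"
  assumes "P \<in> U_mats" "continuous_on S f"
  shows "continuous_on S (\<lambda>x. conjugate P (f x))"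
  unfolding conjugate_U[OF assms(1)] using assms(2) by (intro continuous_intros)

text \<open>Boundedness holds since the entries have absolute value at most 1, because the columns are unit vectors.\<close>

lemma compact_SU_mats: "compact (SU_mats :: ('r::finite) cmat set)"
proof -
  let ?f = "\<lambda>A :: 'r cmat. (conj_transpose A ** A, det A)"
  have eq: "SU_mats = ?f -` {(mat 1, 1)}"
    using U_mats_left U_matsI by (auto simp: SU_mats_def)
  have "continuous_on UNIV ?f" by (intro continuous_intros)
  then have "closed (SU_mats :: 'r cmat set)"
    unfolding eq by (intro closed_vimage) auto
  moreover have "bounded (SU_mats :: 'r cmat set)"
  proof (rule boundedI)
    fix A :: "'r cmat" assume "A \<in> SU_mats"
    have entry: "cmod (A $ i $ j) \<le> 1" for i j
    proof -
      have "(\<Sum>k\<in>UNIV. (cmod (A $ k $ j))\<^sup>2) = 1"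
      proof -
        have "(conj_transpose A ** A) $ j $ j = 1"
          using \<open>A \<in> SU_mats\<close> by (simp add: U_mats_left SU_mats_imp_U mat_def)
        then have "complex_of_real (\<Sum>k\<in>UNIV. (cmod (A $ k $ j))\<^sup>2) = 1"
          by (simp add: mat_mult_component complex_norm_square mult.commute del: of_real_power)
        then show ?thesis by (simp only: of_real_eq_1_iff)
      qed
      moreover have "(cmod (A $ i $ j))\<^sup>2 \<le> (\<Sum>k\<in>UNIV. (cmod (A $ k $ j))\<^sup>2)"
        by (rule member_le_sum) auto
      ultimately have "(cmod (A $ i $ j))\<^sup>2 \<le> 1\<^sup>2" by simp
      then show ?thesis by (rule power2_le_imp_le) simp
    qed
    have "norm A \<le> (\<Sum>i\<in>UNIV. norm (A $ i))"
      unfolding norm_vec_def[of A] by (rule L2_set_le_sum) simp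
    also have "\<dots> \<le> (\<Sum>i\<in>(UNIV :: 'r set). \<Sum>j\<in>(UNIV :: 'r set). 1)"
    proof (rule sum_mono)
      fix i
      have "norm (A $ i) \<le> (\<Sum>j\<in>UNIV. cmod (A $ i $ j))"
        unfolding norm_vec_def[of "A $ i"] by (rule L2_set_le_sum) simp
      also have "\<dots> \<le> (\<Sum>j\<in>(UNIV :: 'r set). 1)" by (rule sum_mono) (rule entry)
      finally show "norm (A $ i) \<le> (\<Sum>j\<in>(UNIV :: 'r set). 1)" .
    qed
    finally show "norm A \<le> (\<Sum>i\<in>(UNIV :: 'r set). \<Sum>j\<in>(UNIV :: 'r set). 1)" .
  qed
  ultimately show ?thesis by (simp add: compact_eq_bounded_closed)
qed

lemma quotient_map_SF:
  "quotient_map (top_of_set {B \<in> SU_mats. irreducible_pair (diag l) B}) (SF l) (Stab_class l)"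
proof -
  let ?F = "{B \<in> SU_mats. irreducible_pair (diag l) B}"
  have irr: "irreducible_pair (diag l) (conjugate P B) \<longleftrightarrow> irreducible_pair (diag l) B"
    if "P \<in> Stab l" for P B
    using that irreducible_pair_conjugate[of P "diag l" B] by (simp add: Stab_def)
  have "open_map (top_of_set SU_mats) (SU_mod_Stab l) (Stab_class l)"
    unfolding SU_mod_Stab_def
  proof (rule orbit_map_open[where G = "Stab l" and act = conjugate])
    fix P assume "P \<in> Stab l"
    then have "P \<in> U_mats" by (rule Stab_U)
    then show "continuous_map (top_of_set SU_mats) (top_of_set SU_mats) (conjugate P)"
      using continuous_on_conjugate[of P SU_mats "\<lambda>x. x"] by (auto simp: SU_mats_conjugate)
  qed (rule Stab_class_eq_iff)
  moreover have "quotient_map (top_of_set SU_mats) (SU_mod_Stab l) (Stab_class l)"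
    unfolding SU_mod_Stab_def by (rule quotient_map_quotient_topology)
  moreover have "{B \<in> topspace (top_of_set SU_mats). Stab_class l B \<in> Stab_class l ` ?F} = ?F"
    using irr by (auto simp: Stab_class_eq_iff)
  ultimately have "quotient_map (subtopology (top_of_set SU_mats) ?F)
      (subtopology (SU_mod_Stab l) (Stab_class l ` ?F)) (Stab_class l)"
    by (intro quotient_map_restrict_saturated)
  moreover have "SU_mats \<inter> ?F = ?F" by auto
  ultimately show ?thesis by (simp add: SF_def subtopology_subtopology)
qed

lemma quotient_map_SX_part:
  "quotient_map (top_of_set {\<rho> \<in> irr_reps n. eigenvalues (fst \<rho>) \<in> SSym \<sigma>})
    (SX_part n \<sigma>) (rep_class :: ('r::finite) cmat \<times> 'r cmat \<Rightarrow> _)"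
proof -
  let ?R = "{\<rho> \<in> irr_reps n. eigenvalues (fst \<rho>) \<in> SSym \<sigma>} :: ('r cmat \<times> 'r cmat) set"
  let ?act = "\<lambda>P (\<rho> :: 'r cmat \<times> 'r cmat). (conjugate P (fst \<rho>), conjugate P (snd \<rho>))"
  have "open_map (top_of_set (irr_reps n)) (SX n) (rep_class :: 'r cmat \<times> 'r cmat \<Rightarrow> _)"
    unfolding SX_def
  proof (rule orbit_map_open[where G = SU_mats and act = ?act])
    fix P :: "'r cmat" assume P: "P \<in> SU_mats"
    have "continuous_on (irr_reps n) (?act P)"
      by (intro continuous_intros continuous_on_conjugate SU_mats_imp_U P)
    then show "continuous_map (top_of_set (irr_reps n)) (top_of_set (irr_reps n)) (?act P)"
      using irr_reps_conjugate[OF P] by auto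
  qed (rule rep_class_eq_iff)
  moreover have "quotient_map (top_of_set (irr_reps n)) (SX n) (rep_class :: 'r cmat \<times> 'r cmat \<Rightarrow> _)"
    unfolding SX_def by (rule quotient_map_quotient_topology)
  moreover have "{\<rho> \<in> topspace (top_of_set (irr_reps n)). rep_class \<rho> \<in> rep_class ` ?R} = ?R"
    by (auto simp: rep_class_eq_iff eigenvalues_conjugate SU_mats_imp_U)
  ultimately have "quotient_map (subtopology (top_of_set (irr_reps n)) ?R)
      (subtopology (SX n) (rep_class ` ?R)) rep_class"
    by (intro quotient_map_restrict_saturated)
  moreover have "irr_reps n \<inter> ?R = ?R" by auto
  moreover have "rep_class ` ?R
      = {rep_class (A, B) | A B. (A, B) \<in> irr_reps n \<and> eigenvalues A \<in> SSym \<sigma>}"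
    by force
  ultimately show ?thesis by (simp add: SX_part_def subtopology_subtopology)
qed


section \<open>The decomposition\<close>

theorem lemma2p4:
  fixes n :: nat and \<sigma> :: "nat list" and l :: "complex^('r::{finite,linorder})"
  assumes "n \<ge> 1"
    and "is_partition \<sigma> CARD('r)"
    and "entries l \<in> Sym \<sigma>"
    and "in_blocks \<sigma> l"
  shows "(SX_part n \<sigma> :: ('r cmat \<times> 'r cmat) set topology)
    homeomorphic_space sum_topology (\<lambda>_. SF l) {..<N_count n \<sigma>}"
proof -
  let ?I = "{..<N_count n \<sigma>}"
  let ?F = "{B \<in> SU_mats. irreducible_pair (diag l) B}"
  let ?R = "{\<rho> \<in> irr_reps n. eigenvalues (fst \<rho>) \<in> SSym \<sigma>} :: ('r cmat \<times> 'r cmat) set"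
  have \<sigma>: "sum_list \<sigma> = CARD('r)" using assms(2) by (simp add: is_partition_def)
  have "finite (SSym_roots n \<sigma>)"
    using assms(1) by (intro finite_SSym_roots) (simp_all add: \<sigma> Suc_le_eq)
  then obtain e where e: "bij_betw e ?I (SSym_roots n \<sigma>)"
    unfolding N_count_def using ex_bij_betw_nat_finite[of "SSym_roots n \<sigma>"]
    by (auto simp: atLeast0LessThan)
  have "\<exists>m :: (complex, 'r) vec. entries m = e i \<and> (\<forall>a b. m $ a = m $ b \<longleftrightarrow> l $ a = l $ b)"
    if "i \<in> ?I" for i
    using bij_betwE[OF e] that
    by (intro ex_vector_same_kernel[OF assms(3)]) (auto simp: SSym_roots_def SSym_def)
  then obtain m :: "nat \<Rightarrow> (complex, 'r) vec" where m: "\<And>i. i \<in> ?I \<Longrightarrow> entries (m i) = e i"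
    "\<And>i a b. i \<in> ?I \<Longrightarrow> m i $ a = m i $ b \<longleftrightarrow> l $ a = l $ b"
    by metis
  have roots: "entries (m i) \<in> SSym_roots n \<sigma>" if "i \<in> ?I" for i
    using m(1)[OF that] bij_betwE[OF e] that by auto
  have irr: "irreducible_pair (diag (m i)) B \<longleftrightarrow> irreducible_pair (diag l) B" if "i \<in> ?I" for i B
    using m(2)[OF that] by (rule irreducible_pair_diag_same_kernel)
  have stab: "Stab (m i) = Stab l" if "i \<in> ?I" for i
    using m(2)[OF that] by (rule Stab_same_kernel)

  \<comment> \<open>The adjoint replaces \<open>matrix_inv\<close> here, to make \<open>h\<close> visibly continuous on the whole product.\<close>
  define h where "h = (\<lambda>(i, P, B). (P ** diag (m i) ** conj_transpose P, P ** B ** conj_transpose P))"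
  define f where "f = (\<lambda>(i, B). rep_class (diag (m i), B))"
  have h: "h (i, P, B) = (conjugate P (diag (m i)), conjugate P B)" if "P \<in> SU_mats" for i P B
    using that by (simp add: h_def conjugate_U SU_mats_imp_U)
  let ?S = "?I \<times> SU_mats \<times> SU_mats"
  let ?K = "?I \<times> (SU_mats :: 'r cmat set) \<times> ?F"
  have hR: "h (i, P, B) \<in> ?R \<longleftrightarrow> B \<in> ?F" if "i \<in> ?I" "P \<in> SU_mats" "B \<in> SU_mats" for i P B
  proof
    assume "h (i, P, B) \<in> ?R"
    then show "B \<in> ?F"
      using that by (simp add: h irr_reps_def irreducible_pair_conjugate SU_mats_imp_U irr)
  next
    assume "B \<in> ?F"
    then have "(diag (m i), B) \<in> irr_reps n"
      using that roots irr by (intro irr_reps_diag) auto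
    then show "h (i, P, B) \<in> ?R"
      using that roots[OF that(1)] irr_reps_conjugate[OF that(2)]
      by (auto simp: h eigenvalues_conjugate SU_mats_imp_U eigenvalues_diag SSym_roots_def)
  qed
  \<comment> \<open>Irreducibility of \<open>h (i, P, B)\<close> depends on \<open>B\<close> alone, so the preimage of \<open>?R\<close> is a product.\<close>
  have K: "{x \<in> ?S. h x \<in> ?R} = ?K" using hR by auto
  have surj: "h ` {x \<in> ?S. h x \<in> ?R} = ?R"
  proof (intro equalityI subsetI)
    fix \<rho> assume "\<rho> \<in> ?R"
    then obtain A B where \<rho>: "\<rho> = (A, B)" "(A, B) \<in> irr_reps n" "eigenvalues A \<in> SSym \<sigma>"
      by (cases \<rho>) auto
    then have AB: "A \<in> U_mats" "B \<in> SU_mats" by (auto simp: irr_reps_def SU_mats_imp_U)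
    obtain c :: "(complex, 'r) vec" where c: "entries c = eigenvalues A"
      using ex_vector_same_kernel[OF assms(3), of "eigenvalues A"] \<rho>(3) by (auto simp: SSym_def)
    obtain P where P: "P \<in> SU_mats" "A = conjugate P (diag c)"
      using U_mats_diagonalizable[OF AB(1) c] by blast
    obtain \<omega> where "\<omega> ^ CARD('r) = 1" "\<And>i. c $ i ^ n = \<omega>"
      using eigenvalues_irr_rep[OF \<rho>(2) P(2)] P(1) by (auto simp: SU_mats_imp_U)
    then have "eigenvalues A \<in> SSym_roots n \<sigma>"
      using \<rho>(3) by (auto simp: SSym_roots_def c[symmetric] \<sigma>)
    then obtain i where i: "i \<in> ?I" "entries (m i) = eigenvalues A"
      using bij_betw_imp_surj_on[OF e] m(1) by (metis imageE)
    obtain Q where Q: "Q \<in> SU_mats" "A = conjugate Q (diag (m i))"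
      using U_mats_diagonalizable[OF AB(1) i(2)] by blast
    let ?B = "conjugate (conj_transpose Q) B"
    have "\<rho> = h (i, Q, ?B)"
      using Q \<rho>(1) by (simp add: h conjugate_inverse SU_mats_imp_U)
    moreover have "(i, Q, ?B) \<in> ?S"
      using i(1) Q(1) AB(2) by (simp add: SU_mats_conjugate U_mats_conj_transpose SU_mats_imp_U)
    ultimately show "\<rho> \<in> h ` {x \<in> ?S. h x \<in> ?R}" using \<open>\<rho> \<in> ?R\<close> by blast
  qed auto
  have "continuous_on ?S h"
    unfolding h_def case_prod_unfold by (intro continuous_intros continuous_on_fst_discrete)
  moreover have "compact ?S"
    by (intro compact_Times compact_SU_mats finite_imp_compact) simp
  ultimately have "quotient_map (top_of_set {x \<in> ?S. h x \<in> ?R}) (top_of_set ?R) h"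
    using surj by (intro compact_map_restrict_quotient)
  then have "quotient_map (top_of_set ?K) (SX_part n \<sigma>) (rep_class \<circ> h)"
    unfolding K using quotient_map_SX_part by (rule quotient_map_compose)
  \<comment> \<open>Conjugation by \<open>P\<close> disappears in the classes, so the quotient map factors through \<open>(i, B)\<close>.\<close>
  then have fpr: "quotient_map (top_of_set ?K) (SX_part n \<sigma>)
      (f \<circ> (\<lambda>(i, P, B). (i, B)))"
  proof (rule quotient_map_eq)
    fix x assume "x \<in> topspace (top_of_set ?K)"
    then obtain i P B where x: "x = (i, P, B)" "P \<in> SU_mats" by auto
    have "rep_class (diag (m i), B) = rep_class (h (i, P, B))"
      unfolding rep_class_eq_iff using x(2) by (auto simp: h)
    then show "(rep_class \<circ> h) x = (f \<circ> (\<lambda>(i, P, B). (i, B))) x" by (simp add: x(1) f_def)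
  qed
  have f_quot: "quotient_map (top_of_set (?I \<times> ?F)) (SX_part n \<sigma>) f"
  proof (rule quotient_map_from_composition[OF _ _ fpr])
    show "continuous_map (top_of_set ?K) (top_of_set (?I \<times> ?F)) (\<lambda>(i, P, B). (i, B))"
      by (auto simp: case_prod_unfold intro!: continuous_intros)
    have "continuous_map (top_of_set (?I \<times> ?F)) (top_of_set ?R) (\<lambda>(i, B). (diag (m i), B))"
    proof -
      have "(diag (m i), B) \<in> ?R" if "i \<in> ?I" "B \<in> ?F" for i B
        using hR[of i "mat 1" B] that by (simp add: h SU_mats_mat_1)
      moreover have "continuous_on (?I \<times> ?F) (\<lambda>(i, B). (diag (m i), B))"
        unfolding case_prod_unfold by (intro continuous_intros continuous_on_fst_discrete)
      ultimately show ?thesis by auto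
    qed
    from continuous_map_compose[OF this quotient_imp_continuous_map[OF quotient_map_SX_part]]
    show "continuous_map (top_of_set (?I \<times> ?F)) (SX_part n \<sigma>) f"
      by (simp add: f_def comp_def case_prod_unfold)
  qed
  \<comment> \<open>The spectrum determines the index, and what can still conjugate \<open>diag (m i)\<close> to itself is \<open>Stab l\<close>.\<close>
  have fibres: "f x = f y \<longleftrightarrow> (case x of (i, B) \<Rightarrow> (i, Stab_class l B)) = (case y of (i, B) \<Rightarrow> (i, Stab_class l B))"
    if xy: "x \<in> topspace (top_of_set (?I \<times> ?F))" "y \<in> topspace (top_of_set (?I \<times> ?F))" for x y
  proof -
    obtain i B j B' where x: "x = (i, B)" "y = (j, B')" and ij: "i \<in> ?I" "j \<in> ?I"
      using xy by auto
    have "f x = f y \<longleftrightarrow> (\<exists>P\<in>SU_mats. conjugate P (diag (m i)) = diag (m j) \<and> conjugate P B = B')"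
      by (simp add: x f_def rep_class_eq_iff)
    also have "\<dots> \<longleftrightarrow> i = j \<and> (\<exists>P\<in>Stab l. conjugate P B = B')"
    proof
      assume "\<exists>P\<in>SU_mats. conjugate P (diag (m i)) = diag (m j) \<and> conjugate P B = B'"
      then obtain P where P: "P \<in> SU_mats" "conjugate P (diag (m i)) = diag (m j)" "conjugate P B = B'"
        by blast
      have "entries (m i) = entries (m j)"
        using arg_cong[OF P(2), of eigenvalues] P(1)
        by (simp add: eigenvalues_conjugate SU_mats_imp_U eigenvalues_diag)
      then have "i = j" using ij m(1) bij_betw_imp_inj_on[OF e] by (metis inj_onD)
      moreover have "P \<in> Stab (m i)" using P(1,2) \<open>i = j\<close> by (simp add: Stab_def SU_mats_imp_U)
      ultimately show "i = j \<and> (\<exists>P\<in>Stab l. conjugate P B = B')"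
        using P(3) stab ij by blast
    next
      assume "i = j \<and> (\<exists>P\<in>Stab l. conjugate P B = B')"
      then obtain P where P: "P \<in> Stab (m i)" "i = j" "conjugate P B = B'" using stab ij by blast
      obtain Q where "Q \<in> SU_mats" "conjugate Q = conjugate P"
        using ex_SU_same_conjugation[OF Stab_U[OF P(1)]] by blast
      then show "\<exists>P\<in>SU_mats. conjugate P (diag (m i)) = diag (m j) \<and> conjugate P B = B'"
        using P by (intro bexI[of _ Q]) (auto simp: Stab_def)
    qed
    finally show ?thesis by (simp add: x Stab_class_eq_iff)
  qed
  show ?thesis
    using f_quot quotient_map_to_sum_of_copies[OF quotient_map_SF] fibres
    by (rule quotient_maps_same_fibres_homeomorphic)
qed

end
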